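(* Let $n\in\mathbb{N}$, let $\phi=(\phi_1,\dots,\phi_n):U^n\to U^n$ be holomorphic, and let $p,q>0$. Consider the condition $$(\ast)\qquad \lim_{\phi(z)\to\partial U^n}\ \sum_{k,l=1}^n\left|\frac{\partial \phi_l}{\partial z_k}(z)\right|\frac{(1-|z_k|^2)^q}{(1-|\phi_l(z)|^2)^p}=0 .$$ (a) If $(\ast)$ holds and there is an $M\ge 0$ such that for all $z\in U^n$ $$\sum_{k,l=1}^n\left|\frac{\partial \phi_l}{\partial z_k}(z)\right|\frac{(1-|z_k|^2)^q}{(1-|\phi_l(z)|^2)^p}\le M,$$ then $C_\phi$ is a compact operator from $\mathcal{B}^p(U^n)$ to $\mathcal{B}^q(U^n)$ and from $\mathcal{B}^p_0(U^n)$ to $\mathcal{B}^q(U^n)$. (b) Let $p\ge 1$ and $q>0$. If $C_\phi$ is a compact operator from $\mathcal{B}^p(U^n)$ to $\mathcal{B}^q(U^n)$ or from $\mathcal{B}^p_0(U^n)$ to $\mathcal{B}^q(U^n)$, then $(\ast)$ holds.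
   Context: $U$ is the open unit disk in $\mathbb{C}$, $U^n\subset\mathbb{C}^n$ is the open unit polydisk, and $\partial U^n$ is its topological boundary. For a holomorphic self-map $\phi$ of $U^n$, the composition operator is $C_\phi f=f\circ\phi$ for $f$ holomorphic on $U^n$. For $p>0$, the $p$-Bloch space $\mathcal{B}^p(U^n)$ is the Banach space of holomorphic $f:U^n\to\mathbb{C}$ with finite norm $$\|f\|_{\mathcal{B}^p}=|f(0)|+\sup_{z\in U^n}\sum_{k=1}^n\left|\frac{\partial f}{\partial z_k}(z)\right|(1-|z_k|^2)^p .$$ The little $p$-Bloch space $\mathcal{B}^p_0(U^n)$ is the closure of the polynomials in $\mathcal{B}^p(U^n)$, with the same norm. The limit condition $\lim_{\phi(z)\to\partial U^n}S(z)=0$ means: for every $\varepsilon>0$ there is $\delta>0$ such that $|S(z)|<\varepsilon$ for all $z\in U^n$ whose image $\phi(z)$ has Euclidean distance less than $\delta$ to $\partial U^n$ (vacuously true if $\phi(U^n)$ stays away from $\partial U^n$). *)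

theory Defs
  imports "HOL-Analysis.Analysis"
begin

section \<open>Holomorphic functions on the polydisk\<close>

definition polydisk :: "(complex ^ 'n) set" where
  "polydisk = {z. \<forall>k. norm (z $ k) < 1}"

text \<open>Holomorphy in several variables: total differentiability with a complex-linear derivative.
  Only applied to open sets \<open>S\<close>.\<close>

definition holomorphic_several_on :: "(complex ^ 'n \<Rightarrow> complex) \<Rightarrow> (complex ^ 'n) set \<Rightarrow> bool" where
  "holomorphic_several_on f S \<longleftrightarrow>
     (\<forall>z\<in>S. \<exists>D. (f has_derivative D) (at z) \<and> (\<forall>c v. D (c *s v) = c * D v))"

definition holomorphic_self_map :: "(complex ^ 'n \<Rightarrow> complex ^ 'n) \<Rightarrow> bool" where
  "holomorphic_self_map \<phi> \<longleftrightarrow>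
     (\<forall>l. holomorphic_several_on (\<lambda>z. \<phi> z $ l) polydisk) \<and> \<phi> ` polydisk \<subseteq> polydisk"

definition partial_deriv :: "'n \<Rightarrow> (complex ^ 'n \<Rightarrow> complex) \<Rightarrow> complex ^ 'n \<Rightarrow> complex" where
  "partial_deriv k f z = deriv (\<lambda>w. f (\<chi> i. if i = k then w else z $ i)) (z $ k)"


section \<open>Spaces of functions and compact operators\<close>

text \<open>A normed space is given by a carrier \<open>X\<close>, which is a complex vector space of functions under
  the pointwise operations, and a norm \<open>N\<close> that is meaningful on \<open>X\<close>. Since the locale
  \<^locale>\<open>Metric_space\<close> asks for nonnegativity outside the carrier as well, the distance is set
  to \<open>0\<close> there.\<close>

definition norm_dist ::
    "('a \<Rightarrow> complex) set \<Rightarrow> (('a \<Rightarrow> complex) \<Rightarrow> real) \<Rightarrow> ('a \<Rightarrow> complex) \<Rightarrow> ('a \<Rightarrow> complex) \<Rightarrow> real" where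
  "norm_dist X N f g = (if f \<in> X \<and> g \<in> X then N (\<lambda>z. f z - g z) else 0)"

definition norm_topology ::
    "('a \<Rightarrow> complex) set \<Rightarrow> (('a \<Rightarrow> complex) \<Rightarrow> real) \<Rightarrow> ('a \<Rightarrow> complex) topology" where
  "norm_topology X N = Metric_space.mtopology X (norm_dist X N)"

definition compact_operator ::
    "('a \<Rightarrow> complex) set \<Rightarrow> (('a \<Rightarrow> complex) \<Rightarrow> real) \<Rightarrow>
     ('b \<Rightarrow> complex) set \<Rightarrow> (('b \<Rightarrow> complex) \<Rightarrow> real) \<Rightarrow>
     (('a \<Rightarrow> complex) \<Rightarrow> ('b \<Rightarrow> complex)) \<Rightarrow> bool" where
  "compact_operator X NX Y NY T \<longleftrightarrow>
     T ` X \<subseteq> Y \<and>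
     (\<forall>f\<in>X. \<forall>g\<in>X. \<forall>a b. T (\<lambda>z. a * f z + b * g z) = (\<lambda>z. a * T f z + b * T g z)) \<and>
     (\<forall>B. B \<subseteq> X \<longrightarrow> (\<exists>C. \<forall>f\<in>B. NX f \<le> C) \<longrightarrow>
        compactin (norm_topology Y NY) (norm_topology Y NY closure_of (T ` B)))"


section \<open>Bloch spaces on the polydisk\<close>

definition bloch_sum :: "real \<Rightarrow> (complex ^ 'n \<Rightarrow> complex) \<Rightarrow> complex ^ 'n \<Rightarrow> real" where
  "bloch_sum p f z = (\<Sum>k\<in>UNIV. norm (partial_deriv k f z) * (1 - (norm (z $ k))\<^sup>2) powr p)"

definition bloch_norm :: "real \<Rightarrow> (complex ^ 'n \<Rightarrow> complex) \<Rightarrow> real" where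
  "bloch_norm p f = norm (f 0) + (SUP z\<in>polydisk. bloch_sum p f z)"

text \<open>Functions on the polydisk are represented by their extension by zero to the whole space, so
  that equality in the Bloch spaces is equality of functions.\<close>

definition bloch_space :: "real \<Rightarrow> (complex ^ 'n \<Rightarrow> complex) set" where
  "bloch_space p = {f. holomorphic_several_on f polydisk \<and>
                       bdd_above (bloch_sum p f ` polydisk) \<and>
                       (\<forall>z. z \<notin> polydisk \<longrightarrow> f z = 0)}"

definition polydisk_polynomials :: "(complex ^ 'n \<Rightarrow> complex) set" where
  "polydisk_polynomials =
     {f. \<exists>(A :: ('n \<Rightarrow> nat) set) c. finite A \<and>
           f = (\<lambda>z. if z \<in> polydisk then \<Sum>\<alpha>\<in>A. c \<alpha> * (\<Prod>i\<in>UNIV. (z $ i) ^ \<alpha> i) else 0)}"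

definition little_bloch_space :: "real \<Rightarrow> (complex ^ 'n \<Rightarrow> complex) set" where
  "little_bloch_space p =
     norm_topology (bloch_space p) (bloch_norm p) closure_of polydisk_polynomials"

definition composition_op ::
    "(complex ^ 'n \<Rightarrow> complex ^ 'n) \<Rightarrow> (complex ^ 'n \<Rightarrow> complex) \<Rightarrow> complex ^ 'n \<Rightarrow> complex" where
  "composition_op \<phi> f = (\<lambda>z. if z \<in> polydisk then f (\<phi> z) else 0)"

definition bloch_quotient ::
    "real \<Rightarrow> real \<Rightarrow> (complex ^ 'n \<Rightarrow> complex ^ 'n) \<Rightarrow> complex ^ 'n \<Rightarrow> real" where
  "bloch_quotient p q \<phi> z =
     (\<Sum>k\<in>UNIV. \<Sum>l\<in>UNIV. norm (partial_deriv k (\<lambda>w. \<phi> w $ l) z) *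
        ((1 - (norm (z $ k))\<^sup>2) powr q / (1 - (norm (\<phi> z $ l))\<^sup>2) powr p))"

text \<open>\<open>S z \<rightarrow> 0\<close> as \<open>\<phi> z\<close> tends to the topological boundary of the polydisk. The boundary is
  nonempty, so \<^const>\<open>infdist\<close> is the actual distance.\<close>

definition tendsto_zero_at_boundary ::
    "(complex ^ 'n \<Rightarrow> complex ^ 'n) \<Rightarrow> (complex ^ 'n \<Rightarrow> real) \<Rightarrow> bool" where
  "tendsto_zero_at_boundary \<phi> S \<longleftrightarrow>
     (\<forall>\<epsilon>>0. \<exists>\<delta>>0. \<forall>z\<in>polydisk. infdist (\<phi> z) (frontier polydisk) < \<delta> \<longrightarrow> \<bar>S z\<bar> < \<epsilon>)"


section \<open>The Bloch spaces are metric spaces\<close>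

lemma open_polydisk: "open (polydisk :: (complex ^ 'n) set)"
proof -
  have "polydisk = (\<Inter>k. {z :: complex ^ 'n. norm (z $ k) < 1})"
    by (auto simp: polydisk_def)
  also have "open \<dots>"
    by (intro open_INT) (auto intro!: open_Collect_less continuous_intros)
  finally show ?thesis .
qed

lemma zero_in_polydisk: "0 \<in> polydisk"
  by (simp add: polydisk_def)

lemma convex_polydisk: "convex (polydisk :: (complex ^ 'n) set)"
proof -
  have "polydisk = (\<Inter>k. {z :: complex ^ 'n. norm (z $ k) < 1})"
    by (auto simp: polydisk_def)
  also have "\<dots> = (\<Inter>k. (\<lambda>z. z $ k) -` ball 0 1)"
    by (auto simp: dist_norm)
  also have "convex \<dots>"
    by (intro convex_INT convex_linear_vimage)
       (auto intro!: bounded_linear.linear bounded_linear_vec_nth)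
  finally show ?thesis .
qed

lemma has_field_derivative_slice:
  fixes f :: "complex ^ 'n \<Rightarrow> complex"
  assumes D: "(f has_derivative D) (at z)" and lin: "\<And>c v. D (c *s v) = c * D v"
  shows "((\<lambda>w. f (\<chi> i. if i = k then w else z $ i)) has_field_derivative D (axis k 1)) (at (z $ k))"
proof -
  let ?g = "\<lambda>w::complex. (\<chi> i. if i = k then w else z $ i)"
  have ax: "bounded_linear (\<lambda>h::complex. axis k h :: complex ^ 'n)"
    by (rule linear_conv_bounded_linear[THEN iffD1])
       (auto intro!: linearI simp: axis_def vec_eq_iff)
  have "((\<lambda>w. z + axis k (w - z $ k)) has_derivative (\<lambda>h. axis k h)) (at (z $ k))"
    by (auto intro!: derivative_eq_intros bounded_linear.has_derivative[OF ax])
  also have "(\<lambda>w. z + axis k (w - z $ k)) = ?g"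
    by (auto simp: vec_eq_iff axis_def fun_eq_iff)
  finally have g: "(?g has_derivative (\<lambda>h. axis k h)) (at (z $ k))" .
  have gz: "?g (z $ k) = z" by (auto simp: vec_eq_iff)
  have "(f has_derivative D) (at (?g (z $ k)))" using D by (simp only: gz)
  from has_derivative_compose[OF g this]
  have "((\<lambda>w. f (?g w)) has_derivative (\<lambda>h. D (axis k h))) (at (z $ k))" .
  also have "(\<lambda>h. D (axis k h)) = (*) (D (axis k 1))"
  proof
    fix h :: complex
    have "axis k h = h *s (axis k 1 :: complex ^ 'n)"
      by (auto simp: vec_eq_iff axis_def)
    then show "D (axis k h) = D (axis k 1) * h" by (simp add: lin)
  qed
  finally show ?thesis by (simp add: has_field_derivative_def)
qed

lemma partial_deriv_eq:
  assumes "(f has_derivative D) (at z)" "\<And>c v. D (c *s v) = c * D v"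
  shows "partial_deriv k f z = D (axis k 1)"
  unfolding partial_deriv_def by (rule DERIV_imp_deriv[OF has_field_derivative_slice[OF assms]])

lemma holomorphic_several_on_diff:
  assumes "holomorphic_several_on f S" "holomorphic_several_on g S"
  shows "holomorphic_several_on (\<lambda>z. f z - g z) S"
  unfolding holomorphic_several_on_def
proof
  fix z assume "z \<in> S"
  with assms obtain D E where
    "(f has_derivative D) (at z)" "\<forall>c v. D (c *s v) = c * D v"
    "(g has_derivative E) (at z)" "\<forall>c v. E (c *s v) = c * E v"
    unfolding holomorphic_several_on_def by blast
  then show "\<exists>D. ((\<lambda>z. f z - g z) has_derivative D) (at z) \<and> (\<forall>c v. D (c *s v) = c * D v)"
    by (intro exI[of _ "\<lambda>v. D v - E v"]) (auto intro!: has_derivative_diff simp: algebra_simps)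
qed

lemma partial_deriv_diff:
  assumes "holomorphic_several_on f S" "holomorphic_several_on g S" "z \<in> S"
  shows "partial_deriv k (\<lambda>z. f z - g z) z = partial_deriv k f z - partial_deriv k g z"
proof -
  from assms obtain D E where
    D: "(f has_derivative D) (at z)" "\<And>c v. D (c *s v) = c * D v" and
    E: "(g has_derivative E) (at z)" "\<And>c v. E (c *s v) = c * E v"
    unfolding holomorphic_several_on_def by blast
  have "partial_deriv k (\<lambda>z. f z - g z) z = D (axis k 1) - E (axis k 1)"
    by (rule partial_deriv_eq[where D = "\<lambda>v. D v - E v"])
       (auto intro!: has_derivative_diff D E simp: D E algebra_simps)
  then show ?thesis by (simp add: partial_deriv_eq[OF D] partial_deriv_eq[OF E])
qed

lemma bloch_sum_nonneg: "bloch_sum p f z \<ge> 0"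
  unfolding bloch_sum_def by (intro sum_nonneg) auto

lemma bloch_sum_diff_le:
  assumes "holomorphic_several_on f S" "holomorphic_several_on g S" "z \<in> S"
  shows "bloch_sum p (\<lambda>z. f z - g z) z \<le> bloch_sum p f z + bloch_sum p g z"
  unfolding bloch_sum_def partial_deriv_diff[OF assms] sum.distrib[symmetric] distrib_right[symmetric]
  by (intro sum_mono mult_right_mono norm_triangle_ineq4) auto

lemma bloch_sum_le_SUP:
  assumes "f \<in> bloch_space p" "z \<in> polydisk"
  shows "bloch_sum p f z \<le> (SUP z\<in>polydisk. bloch_sum p f z)"
  using assms by (intro cSUP_upper) (auto simp: bloch_space_def)

lemma bloch_norm_nonneg:
  assumes "f \<in> bloch_space p"
  shows "bloch_norm p f \<ge> 0"
  using order_trans[OF bloch_sum_nonneg bloch_sum_le_SUP[OF assms zero_in_polydisk]]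
  by (simp add: bloch_norm_def)

lemma bloch_space_diff:
  assumes f: "f \<in> bloch_space p" and g: "g \<in> bloch_space p"
  shows "(\<lambda>z. f z - g z) \<in> bloch_space p"
    and "bloch_norm p (\<lambda>z. f z - g z) \<le> bloch_norm p f + bloch_norm p g"
proof -
  have hol: "holomorphic_several_on f polydisk" "holomorphic_several_on g polydisk"
    using f g by (auto simp: bloch_space_def)
  have le: "bloch_sum p (\<lambda>z. f z - g z) z
      \<le> (SUP z\<in>polydisk. bloch_sum p f z) + (SUP z\<in>polydisk. bloch_sum p g z)"
    if "z \<in> polydisk" for z
    using bloch_sum_diff_le[OF hol that, of p] bloch_sum_le_SUP[OF f that] bloch_sum_le_SUP[OF g that]
    by linarith
  then have "bdd_above (bloch_sum p (\<lambda>z. f z - g z) ` polydisk)"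
    by (intro bdd_aboveI2)
  with hol f g show "(\<lambda>z. f z - g z) \<in> bloch_space p"
    by (auto simp: bloch_space_def holomorphic_several_on_diff)
  have "(SUP z\<in>polydisk. bloch_sum p (\<lambda>z. f z - g z) z)
      \<le> (SUP z\<in>polydisk. bloch_sum p f z) + (SUP z\<in>polydisk. bloch_sum p g z)"
    using zero_in_polydisk by (intro cSUP_least le) auto
  then show "bloch_norm p (\<lambda>z. f z - g z) \<le> bloch_norm p f + bloch_norm p g"
    using norm_triangle_ineq4[of "f 0" "g 0"] by (simp add: bloch_norm_def)
qed

lemma bloch_norm_zero: "bloch_norm p (\<lambda>z :: complex ^ 'n. 0) = 0"
proof -
  have "polydisk \<noteq> ({} :: (complex ^ 'n) set)" using zero_in_polydisk by blast
  then show ?thesis by (simp add: bloch_norm_def bloch_sum_def partial_deriv_def)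
qed

lemma bloch_norm_eq_0_imp:
  assumes f: "f \<in> bloch_space p" and 0: "bloch_norm p f = 0"
  shows "f = (\<lambda>z. 0)"
proof -
  have SUP0: "0 \<le> (SUP z\<in>polydisk. bloch_sum p f z)"
    using order_trans[OF bloch_sum_nonneg bloch_sum_le_SUP[OF f zero_in_polydisk]] .
  from 0 SUP0 have f0: "f 0 = 0" and S0: "(SUP z\<in>polydisk. bloch_sum p f z) = 0"
    by (simp_all add: bloch_norm_def add_nonneg_eq_0_iff)
  have der: "(f has_derivative (\<lambda>v. 0)) (at z within polydisk)" if z: "z \<in> polydisk" for z
  proof -
    from f z obtain D where D: "(f has_derivative D) (at z)" "\<And>c v. D (c *s v) = c * D v"
      unfolding bloch_space_def holomorphic_several_on_def by blast
    have "bloch_sum p f z = 0"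
      using bloch_sum_le_SUP[OF f z] bloch_sum_nonneg[of p f z] S0 by linarith
    then have "norm (partial_deriv k f z) * (1 - (norm (z $ k))\<^sup>2) powr p = 0" for k
      unfolding bloch_sum_def by (subst (asm) sum_nonneg_eq_0_iff) auto
    moreover have "(1 - (norm (z $ k))\<^sup>2) powr p \<noteq> 0" for k
      using z abs_square_less_1[of "norm (z $ k)"] by (auto simp: polydisk_def)
    ultimately have Dk: "D (axis k 1) = 0" for k
      by (metis mult_eq_0_iff norm_eq_zero partial_deriv_eq[OF D])
    have "D v = 0" for v
    proof -
      have "D v = D (\<Sum>k\<in>UNIV. v $ k *s axis k 1)" by (simp add: basis_expansion)
      also have "\<dots> = (\<Sum>k\<in>UNIV. D (v $ k *s axis k 1))"
        by (rule linear_sum[OF has_derivative_linear[OF D(1)]])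
      finally show ?thesis by (simp add: D(2) Dk)
    qed
    then have "D = (\<lambda>v. 0)" by auto
    with D(1) show ?thesis by (auto intro: has_derivative_at_withinI)
  qed
  show ?thesis
  proof
    fix z
    show "f z = 0"
    proof (cases "z \<in> polydisk")
      case True
      then show ?thesis
        using has_derivative_zero_unique[OF convex_polydisk der True zero_in_polydisk] f0 by simp
    qed (use f in \<open>auto simp: bloch_space_def\<close>)
  qed
qed

lemma Metric_space_bloch:
  "Metric_space (bloch_space p :: (complex ^ 'n \<Rightarrow> complex) set) (norm_dist (bloch_space p) (bloch_norm p))"
proof
  fix f g h :: "complex ^ 'n \<Rightarrow> complex"
  let ?X = "bloch_space p" and ?d = "norm_dist (bloch_space p) (bloch_norm p)"
  have d: "?d f g = bloch_norm p (\<lambda>z. f z - g z)" if "f \<in> ?X" "g \<in> ?X"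
    for f g :: "complex ^ 'n \<Rightarrow> complex"
    using that by (simp add: norm_dist_def)
  show "0 \<le> ?d f g"
    by (auto simp: norm_dist_def intro!: bloch_norm_nonneg bloch_space_diff)
  have zero_in: "(\<lambda>z :: complex ^ 'n. 0) \<in> ?X" if "f \<in> ?X" for f :: "complex ^ 'n \<Rightarrow> complex"
    using bloch_space_diff(1)[OF that that] by simp
  have "?d f g \<le> ?d g f" if "f \<in> ?X" "g \<in> ?X" for f g :: "complex ^ 'n \<Rightarrow> complex"
    using bloch_space_diff(2)[OF zero_in[OF that(1)] bloch_space_diff(1)[OF that(2,1)]] that
    by (simp add: d bloch_norm_zero)
  then show "?d f g = ?d g f"
    by (cases "f \<in> ?X \<and> g \<in> ?X") (auto simp: norm_dist_def intro: antisym)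
  note comm = this
  show "?d f g = 0 \<longleftrightarrow> f = g" if "f \<in> ?X" "g \<in> ?X"
    using that bloch_norm_eq_0_imp[OF bloch_space_diff(1)[OF that]]
    by (auto simp: d bloch_norm_zero fun_eq_iff)
  show "?d f h \<le> ?d f g + ?d g h" if X: "f \<in> ?X" "g \<in> ?X" "h \<in> ?X"
  proof -
    have "?d h g = ?d g h"
      using bloch_space_diff(2)[OF zero_in[OF X(1)] bloch_space_diff(1)[OF X(2,3)]]
        bloch_space_diff(2)[OF zero_in[OF X(1)] bloch_space_diff(1)[OF X(3,2)]] X
      by (simp add: d bloch_norm_zero)
    then show ?thesis
      using bloch_space_diff(2)[OF bloch_space_diff(1)[OF X(1,2)] bloch_space_diff(1)[OF X(3,2)]] X
      by (simp add: d)
  qed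
qed

end

theory Submission
  imports Defs "HOL-Complex_Analysis.Great_Picard"
begin

text \<open>
  Both parts rest on the chain rule \<open>\<partial>\<^sub>k (f \<circ> \<phi>) = (\<Sum>l. (\<partial>\<^sub>l f \<circ> \<phi>) \<partial>\<^sub>k \<phi>\<^sub>l)\<close>, and since the little Bloch space is
  a subspace, part (a) is only needed for the large space and part (b) only for the little one.

  For (a), Montel's theorem gives in every bounded sequence of \<open>\<B>\<^sup>p\<close> a subsequence whose
  gradients converge uniformly on compact subsets of the polydisk. The images converge in
  \<open>\<B>\<^sup>q\<close>: where \<open>\<phi> z\<close> is near the boundary the quotient is small, and elsewhere \<open>\<phi> z\<close> stays in a
  compact set.

  For (b), a compact operator maps a bounded sequence that tends to 0 pointwise to one with a norm
  null subsequence. If a term \<open>(k, l)\<close> of the quotient stays away from 0 along points with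
  \<open>w = \<phi> z\<close>, \<open>\<bar>w\<^sub>m\<bar> \<rightarrow> 1\<close>, this is contradicted by polynomials: for \<open>m = l\<close> by
  \<open>N\<^sup>p\<^sup>-\<^sup>1 z\<^sub>l\<^sup>N\<close> with \<open>N\<close> of the order of \<open>1 / (1 - \<bar>w\<^sub>l\<bar>\<^sup>2)\<close>, and for \<open>m \<noteq> l\<close>, where \<open>w\<^sub>l\<close> may be
  assumed to stay away from the unit circle, by \<open>(z\<^sub>l - w\<^sub>l) z\<^sub>m\<^sup>N\<close>, which is bounded in \<open>\<B>\<^sup>p\<close>
  because \<open>p \<ge> 1\<close>.
\<close>

section \<open>Closed polydisks and the boundary\<close>

definition closed_polydisk :: "real \<Rightarrow> (complex ^ 'n) set" where
  "closed_polydisk r = {z. \<forall>k. norm (z $ k) \<le> r}"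

lemma closed_polydisk_subset_polydisk: "r < 1 \<Longrightarrow> closed_polydisk r \<subseteq> polydisk"
  unfolding closed_polydisk_def polydisk_def using le_less_trans by blast

lemma closed_polydisk_mono: "r \<le> s \<Longrightarrow> closed_polydisk r \<subseteq> closed_polydisk s"
  unfolding closed_polydisk_def using order_trans by blast

lemma zero_in_closed_polydisk: "0 \<le> r \<Longrightarrow> 0 \<in> closed_polydisk r"
  by (simp add: closed_polydisk_def)

lemma closed_polydisk_eq_INT: "closed_polydisk r = (\<Inter>k. (\<lambda>z. z $ k) -` cball 0 r)"
  by (auto simp: closed_polydisk_def)

lemma convex_closed_polydisk: "convex (closed_polydisk r :: (complex ^ 'n) set)"
  unfolding closed_polydisk_eq_INT
  by (intro convex_INT convex_linear_vimage) (auto intro!: bounded_linear.linear bounded_linear_vec_nth)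

lemma compact_closed_polydisk: "compact (closed_polydisk r :: (complex ^ 'n) set)"
proof -
  have "closed (closed_polydisk r :: (complex ^ 'n) set)"
    unfolding closed_polydisk_eq_INT
    by (intro closed_INT ballI closed_vimage) (auto intro!: continuous_intros)
  moreover have "norm z \<le> real CARD('n) * r" if "z \<in> closed_polydisk r" for z :: "complex ^ 'n"
  proof -
    have "norm z \<le> (\<Sum>k\<in>UNIV. norm (z $ k))"
      by (simp add: norm_le_componentwise_cart norm_vec_def L2_set_le_sum)
    also have "\<dots> \<le> (\<Sum>k\<in>(UNIV :: 'n set). r)"
      using that by (intro sum_mono) (auto simp: closed_polydisk_def)
    finally show ?thesis by simp
  qed
  then have "bounded (closed_polydisk r :: (complex ^ 'n) set)"
    by (auto simp: bounded_iff)
  ultimately show ?thesis by (simp add: compact_eq_bounded_closed)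
qed

lemma in_closed_polydisk_of_polydisk:
  fixes z :: "complex ^ 'n"
  assumes "z \<in> polydisk"
  obtains r where "0 < r" "r < 1" "z \<in> closed_polydisk r"
proof -
  define m where "m = Max (range (\<lambda>k. norm (z $ k)))"
  have "m \<in> range (\<lambda>k. norm (z $ k))" unfolding m_def by (intro Max_in) auto
  then have m: "m < 1" "0 \<le> m" using assms by (auto simp: polydisk_def)
  have "norm (z $ k) \<le> m" for k unfolding m_def by (rule Max_ge) auto
  moreover have "m \<le> (1 + m) / 2" using m by simp
  ultimately have "norm (z $ k) \<le> (1 + m) / 2" for k by (rule order_trans)
  then have "z \<in> closed_polydisk ((1 + m) / 2)" by (simp add: closed_polydisk_def)
  then show thesis using m by (intro that[of "(1 + m) / 2"]) auto
qed

text \<open>The frontier is closed and nonempty, so the distance is attained at some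
  \<open>y\<close>. As the polydisk is open, \<open>y\<close> lies outside it and has a coordinate
  of modulus at least 1; coordinate projections do not increase distances.\<close>

lemma infdist_frontier_polydisk_less:
  fixes w :: "complex ^ 'n"
  assumes "infdist w (frontier polydisk) < \<delta>"
  obtains m where "1 - norm (w $ m) < \<delta>"
proof -
  have "(\<chi> i. 1) \<notin> (polydisk :: (complex ^ 'n) set)" by (simp add: polydisk_def)
  then have "polydisk \<noteq> (UNIV :: (complex ^ 'n) set)" by blast
  moreover have "polydisk \<noteq> ({} :: (complex ^ 'n) set)" using zero_in_polydisk by blast
  ultimately have "frontier polydisk \<noteq> ({} :: (complex ^ 'n) set)" by (simp add: frontier_eq_empty)
  then obtain y where y: "y \<in> frontier polydisk" "infdist w (frontier polydisk) = dist w y"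
    using infdist_attains_inf[OF frontier_closed] by blast
  have "y \<notin> polydisk" using y(1) by (simp add: frontier_def interior_open[OF open_polydisk])
  then obtain m where "1 \<le> norm (y $ m)" by (auto simp: polydisk_def not_less)
  moreover have "norm (y $ m - w $ m) < \<delta>"
    using Finite_Cartesian_Product.norm_nth_le[of "y - w" m] assms y(2)
    by (simp add: dist_norm norm_minus_commute)
  ultimately have "1 - norm (w $ m) < \<delta>" using norm_triangle_ineq2[of "y $ m" "w $ m"] by linarith
  then show thesis by (rule that)
qed

lemma norm_axis:
  fixes c :: "'a::real_normed_vector"
  shows "norm (axis m c :: 'a ^ 'n) = norm c"
proof -
  have "(norm (axis m c $ i :: 'a))\<^sup>2 = (if i = m then (norm c)\<^sup>2 else 0)" for i :: 'n
    by (simp add: axis_def)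
  then show ?thesis by (simp add: norm_vec_def L2_set_def)
qed

text \<open>If some coordinate had modulus above \<open>1 - \<delta>\<close>, moving it radially to
  the unit circle would leave the polydisk by a step shorter than \<open>\<delta>\<close>, and the
  ball of that radius would meet the frontier.\<close>

lemma le_infdist_frontier_polydisk:
  fixes w :: "complex ^ 'n"
  assumes w: "w \<in> polydisk" and \<delta>: "\<delta> \<le> infdist w (frontier polydisk)"
  shows "w \<in> closed_polydisk (1 - \<delta>)"
proof (rule ccontr)
  assume "w \<notin> closed_polydisk (1 - \<delta>)"
  then obtain m where m: "1 - \<delta> < norm (w $ m)" by (auto simp: closed_polydisk_def not_le)
  \<comment> \<open>The radial direction of the coordinate. At 0 any unit number serves, while
    \<open>sgn 0 = 0\<close> would not.\<close>
  define u where "u = (if w $ m = 0 then 1 else sgn (w $ m))"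
  define y where "y = w + axis m (complex_of_real (1 - norm (w $ m)) * u)"
  have wm: "norm (w $ m) < 1" using w by (simp add: polydisk_def)
  have "norm u = 1" by (simp add: u_def norm_sgn)
  then have "norm (axis m (complex_of_real (1 - norm (w $ m)) * u) :: complex ^ 'n) = 1 - norm (w $ m)"
    using wm norm_of_real[of "1 - norm (w $ m)", where 'a = complex] by (simp add: norm_axis norm_mult del: of_real_diff)
  then have "dist w y < \<delta>" using m by (simp add: y_def dist_norm)
  have "w $ m = complex_of_real (norm (w $ m)) * u"
    by (simp add: u_def sgn_eq)
  then have "y $ m = u" by (simp add: y_def algebra_simps)
  then have "y \<notin> polydisk" using \<open>norm u = 1\<close> by (auto simp: polydisk_def intro!: exI[of _ m])
  moreover have "0 < \<delta>" using \<open>dist w y < \<delta>\<close> zero_le_dist[of w y] by linarith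
  \<comment> \<open>The ball is connected and contains \<open>w\<close> inside and \<open>y\<close>
    outside the polydisk.\<close>
  ultimately have "ball w \<delta> \<inter> frontier polydisk \<noteq> {}"
    using w \<open>dist w y < \<delta>\<close> centre_in_ball[of w \<delta>]
    by (intro connected_Int_frontier) (blast intro: connected_ball, blast, auto)
  then obtain v where "v \<in> frontier polydisk" "dist w v < \<delta>" by auto
  then show False using infdist_le[of v "frontier polydisk" w] \<delta> by linarith
qed

section \<open>The chain rule\<close>

text \<open>A complex linear map is determined by its values on the axis vectors, and these values
  are the partial derivatives.\<close>

lemma holomorphic_several_on_gradient:
  assumes "holomorphic_several_on f S" "z \<in> S"
  shows "(f has_derivative (\<lambda>v. \<Sum>k\<in>UNIV. partial_deriv k f z * v $ k)) (at z)"
proof -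
  obtain D where D: "(f has_derivative D) (at z)" "\<And>c v. D (c *s v) = c * D v"
    using assms unfolding holomorphic_several_on_def by blast
  have "D v = (\<Sum>k\<in>UNIV. partial_deriv k f z * v $ k)" for v
  proof -
    have "D v = D (\<Sum>k\<in>UNIV. v $ k *s axis k 1)" by (simp add: basis_expansion)
    also have "\<dots> = (\<Sum>k\<in>UNIV. D (v $ k *s axis k 1))"
      by (rule linear_sum[OF has_derivative_linear[OF D(1)]])
    finally show ?thesis by (simp add: D(2) partial_deriv_eq[OF D] mult.commute)
  qed
  then have "D = (\<lambda>v. \<Sum>k\<in>UNIV. partial_deriv k f z * v $ k)" by auto
  with D show ?thesis by simp
qed

lemma holomorphic_several_onI:
  assumes "\<And>z. z \<in> S \<Longrightarrow> (f has_derivative (\<lambda>v. \<Sum>k\<in>UNIV. c z k * v $ k)) (at z)"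
  shows "holomorphic_several_on f S"
  unfolding holomorphic_several_on_def
  using assms by (fastforce simp: sum_distrib_left algebra_simps)

lemma partial_deriv_eqI:
  fixes z :: "complex ^ 'n"
  assumes "(f has_derivative (\<lambda>v. \<Sum>k\<in>UNIV. c k * v $ k)) (at z)"
  shows "partial_deriv k f z = c k"
  by (subst partial_deriv_eq[OF assms]) (simp_all add: sum_distrib_left algebra_simps axis_def if_distrib cong: if_cong)

lemma has_derivative_transform_polydisk:
  assumes "(g has_derivative D) (at z)" "z \<in> polydisk"
    and "\<And>w. w \<in> polydisk \<Longrightarrow> f w = g w"
  shows "(f has_derivative D) (at z)"
  by (rule has_derivative_transform_within_open[OF assms(1) open_polydisk assms(2)]) (simp add: assms(3))

text \<open>Differentiability of \<open>\<phi>\<close> is known coordinate by coordinate only, so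
  the total derivative is first assembled from the axis embeddings of the coordinates; interchanging
  the two finite sums then gives the coefficients.\<close>

lemma has_derivative_chain_several:
  fixes \<phi> :: "complex ^ 'n \<Rightarrow> complex ^ 'm"
  assumes f: "(f has_derivative (\<lambda>v. \<Sum>l\<in>UNIV. c l * v $ l)) (at (\<phi> z))"
    and \<phi>: "\<And>l. ((\<lambda>w. \<phi> w $ l) has_derivative (\<lambda>v. \<Sum>k\<in>UNIV. d l k * v $ k)) (at z)"
  shows "((\<lambda>w. f (\<phi> w)) has_derivative (\<lambda>v. \<Sum>k\<in>UNIV. (\<Sum>l\<in>UNIV. c l * d l k) * v $ k)) (at z)"
proof -
  have ax: "bounded_linear (\<lambda>h::complex. axis l h :: complex ^ 'm)" for l
    by (rule linear_conv_bounded_linear[THEN iffD1])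
       (auto intro!: linearI simp: axis_def vec_eq_iff)
  have expand: "(\<Sum>l\<in>UNIV. axis l (u $ l)) = u" for u :: "complex ^ 'm"
    by (simp add: vec_eq_iff axis_def)
  have "((\<lambda>w. \<Sum>l\<in>UNIV. axis l (\<phi> w $ l)) has_derivative
      (\<lambda>v. \<Sum>l\<in>UNIV. axis l (\<Sum>k\<in>UNIV. d l k * v $ k))) (at z)"
    by (intro has_derivative_sum bounded_linear.has_derivative[OF ax] \<phi>)
  then have "(\<phi> has_derivative (\<lambda>v. \<Sum>l\<in>UNIV. axis l (\<Sum>k\<in>UNIV. d l k * v $ k))) (at z)"
    by (simp only: expand)
  from has_derivative_compose[OF this f]
  have "((\<lambda>w. f (\<phi> w)) has_derivative
      (\<lambda>v. \<Sum>l\<in>UNIV. c l * (\<Sum>l'\<in>UNIV. axis l' (\<Sum>k\<in>UNIV. d l' k * v $ k)) $ l)) (at z)" .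
  moreover have nth: "(\<Sum>l'\<in>UNIV. axis l' (u l') :: complex ^ 'm) $ l = u l" for u l
    by (simp add: axis_def)
  moreover have swap: "(\<Sum>l\<in>UNIV. c l * (\<Sum>k\<in>UNIV. d l k * v $ k)) =
      (\<Sum>k\<in>UNIV. (\<Sum>l\<in>UNIV. c l * d l k) * v $ k)" for v :: "complex ^ 'n"
    unfolding sum_distrib_left sum_distrib_right by (subst sum.swap) (simp add: mult.assoc)
  ultimately show ?thesis by (simp only: nth swap)
qed

text \<open>The cutoff in \<open>composition_op\<close> does not affect derivatives at points of the
  open polydisk.\<close>

lemma has_derivative_composition_op:
  assumes \<phi>: "holomorphic_self_map \<phi>" and f: "holomorphic_several_on f polydisk" and z: "z \<in> polydisk"
  shows "(composition_op \<phi> f has_derivative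
      (\<lambda>v. \<Sum>k\<in>UNIV. (\<Sum>l\<in>UNIV. partial_deriv l f (\<phi> z) * partial_deriv k (\<lambda>w. \<phi> w $ l) z) * v $ k)) (at z)"
proof (rule has_derivative_transform_polydisk[OF _ z])
  show "((\<lambda>w. f (\<phi> w)) has_derivative
      (\<lambda>v. \<Sum>k\<in>UNIV. (\<Sum>l\<in>UNIV. partial_deriv l f (\<phi> z) * partial_deriv k (\<lambda>w. \<phi> w $ l) z) * v $ k)) (at z)"
    using \<phi> z by (intro has_derivative_chain_several holomorphic_several_on_gradient[OF f]
        holomorphic_several_on_gradient[of _ polydisk]) (auto simp: holomorphic_self_map_def)
qed (simp add: composition_op_def)

section \<open>Estimates in Bloch spaces\<close>

lemma weight_pos:
  assumes "z \<in> polydisk"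
  shows "0 < 1 - (norm (z $ k))\<^sup>2"
  using assms abs_square_less_1[of "norm (z $ k)"] by (simp add: polydisk_def)

lemma weight_le_1:
  assumes "z \<in> polydisk" "0 \<le> p"
  shows "(1 - (norm (z $ k))\<^sup>2) powr p \<le> 1"
  using powr_mono2[of p "1 - (norm (z $ k))\<^sup>2" 1] weight_pos[OF assms(1), of k] assms(2) by simp

lemma norm_at_zero_le_bloch_norm:
  assumes f: "f \<in> bloch_space p"
  shows "norm (f 0) \<le> bloch_norm p f"
  using order_trans[OF bloch_sum_nonneg bloch_sum_le_SUP[OF f zero_in_polydisk]]
  by (simp add: bloch_norm_def)

lemma partial_deriv_le_bloch_norm:
  assumes f: "f \<in> bloch_space p" and z: "z \<in> polydisk"
  shows "norm (partial_deriv k f z) * (1 - (norm (z $ k))\<^sup>2) powr p \<le> bloch_norm p f"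
proof -
  have "norm (partial_deriv k f z) * (1 - (norm (z $ k))\<^sup>2) powr p \<le> bloch_sum p f z"
    unfolding bloch_sum_def by (rule member_le_sum) auto
  then show ?thesis
    using bloch_sum_le_SUP[OF f z] norm_ge_zero[of "f 0"] unfolding bloch_norm_def by linarith
qed

lemma partial_deriv_bound:
  assumes f: "f \<in> bloch_space p" and p: "0 \<le> p" and z: "z \<in> closed_polydisk r" and r: "r < 1"
  shows "norm (partial_deriv k f z) \<le> bloch_norm p f / (1 - r\<^sup>2) powr p"
proof -
  have zk: "norm (z $ k) \<le> r" using z by (simp add: closed_polydisk_def)
  then have "0 \<le> r" using norm_ge_zero[of "z $ k"] by linarith
  then have r2: "0 < 1 - r\<^sup>2" using r abs_square_less_1[of r] by simp
  have "(norm (z $ k))\<^sup>2 \<le> r\<^sup>2" using zk by (intro power_mono) auto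
  then have "(1 - r\<^sup>2) powr p \<le> (1 - (norm (z $ k))\<^sup>2) powr p"
    using p r2 by (intro powr_mono2) auto
  then have "norm (partial_deriv k f z) * (1 - r\<^sup>2) powr p \<le> bloch_norm p f"
    using partial_deriv_le_bloch_norm[OF f subsetD[OF closed_polydisk_subset_polydisk[OF r] z], of k]
    by (meson mult_left_mono norm_ge_zero order_trans)
  then show ?thesis using r2 by (simp add: field_simps)
qed

text \<open>Mean value inequality on a convex set. The constant depends on \<open>f\<close> only
  through its norm, so norm-bounded families are equicontinuous on each closed polydisk.\<close>

lemma bloch_lipschitz:
  fixes f :: "complex ^ 'n \<Rightarrow> complex"
  assumes f: "f \<in> bloch_space p" and p: "0 \<le> p" and r: "r < 1"
    and z: "z \<in> closed_polydisk r" and w: "w \<in> closed_polydisk r"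
  shows "norm (f z - f w) \<le> real CARD('n) / (1 - r\<^sup>2) powr p * bloch_norm p f * norm (z - w)"
proof (rule differentiable_bound[OF convex_closed_polydisk, where
      f' = "\<lambda>x v. \<Sum>k\<in>UNIV. partial_deriv k f x * v $ k"])
  fix x :: "complex ^ 'n" assume x: "x \<in> closed_polydisk r"
  let ?D = "\<lambda>v. \<Sum>k\<in>UNIV. partial_deriv k f x * v $ k"
  show "(f has_derivative ?D) (at x within closed_polydisk r)"
  proof (rule has_derivative_at_withinI, rule holomorphic_several_on_gradient)
    show "holomorphic_several_on f polydisk" using f by (simp add: bloch_space_def)
    show "x \<in> polydisk" using x closed_polydisk_subset_polydisk[OF r] by blast
  qed
  show "onorm ?D \<le> real CARD('n) / (1 - r\<^sup>2) powr p * bloch_norm p f"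
  proof (rule onorm_le)
    fix v :: "complex ^ 'n"
    have "norm (partial_deriv k f x * v $ k) \<le> bloch_norm p f / (1 - r\<^sup>2) powr p * norm v" for k
      unfolding norm_mult
      by (intro mult_mono partial_deriv_bound[OF f p x r] Finite_Cartesian_Product.norm_nth_le divide_nonneg_nonneg
          bloch_norm_nonneg[OF f]) auto
    then have "norm (?D v) \<le> (\<Sum>k\<in>(UNIV::'n set). bloch_norm p f / (1 - r\<^sup>2) powr p * norm v)"
      by (rule sum_norm_le)
    then show "norm (?D v) \<le> real CARD('n) / (1 - r\<^sup>2) powr p * bloch_norm p f * norm v" by simp
  qed
qed (fact z w)+

text \<open>The value at 0 is part of the norm, and the Lipschitz bound carries it to
  \<open>z\<close>. Hence norm convergence implies pointwise convergence.\<close>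

lemma bloch_pointwise_bound:
  fixes z :: "complex ^ 'n"
  assumes p: "0 \<le> p" and z: "z \<in> polydisk"
  obtains K where "\<And>f. f \<in> bloch_space p \<Longrightarrow> norm (f z) \<le> K * bloch_norm p f"
proof -
  obtain r where r: "0 < r" "r < 1" "z \<in> closed_polydisk r"
    using in_closed_polydisk_of_polydisk[OF z] .
  show thesis
  proof (rule that[of "1 + real CARD('n) / (1 - r\<^sup>2) powr p * norm z"])
    fix f :: "complex ^ 'n \<Rightarrow> complex" assume f: "f \<in> bloch_space p"
    have "norm (f 0) \<le> bloch_norm p f" by (rule norm_at_zero_le_bloch_norm[OF f])
    moreover have "norm (f z - f 0) \<le> real CARD('n) / (1 - r\<^sup>2) powr p * bloch_norm p f * norm (z - 0)"
      using r by (intro bloch_lipschitz f p zero_in_closed_polydisk) auto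
    ultimately show "norm (f z) \<le> (1 + real CARD('n) / (1 - r\<^sup>2) powr p * norm z) * bloch_norm p f"
      using norm_triangle_sub[of "f z" "f 0"] by (simp add: algebra_simps)
  qed
qed

lemma bloch_norm_le:
  fixes f :: "complex ^ 'n \<Rightarrow> complex"
  assumes "\<And>z. z \<in> polydisk \<Longrightarrow> bloch_sum p f z \<le> A"
  shows "bloch_norm p f \<le> norm (f 0) + A"
  unfolding bloch_norm_def using assms zero_in_polydisk by (auto intro!: cSUP_least)

lemma bloch_spaceI:
  fixes f :: "complex ^ 'n \<Rightarrow> complex"
  assumes der: "\<And>z. z \<in> polydisk \<Longrightarrow> (f has_derivative (\<lambda>v. \<Sum>k\<in>UNIV. c z k * v $ k)) (at z)"
    and le: "\<And>z. z \<in> polydisk \<Longrightarrow> (\<Sum>k\<in>UNIV. norm (c z k) * (1 - (norm (z $ k))\<^sup>2) powr p) \<le> A"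
    and zero: "\<And>z. z \<notin> polydisk \<Longrightarrow> f z = 0"
  shows "f \<in> bloch_space p" and "bloch_norm p f \<le> norm (f 0) + A"
proof -
  have sum: "bloch_sum p f z \<le> A" if "z \<in> polydisk" for z
    using le[OF that] by (simp add: bloch_sum_def partial_deriv_eqI[OF der[OF that]])
  then have "bdd_above (bloch_sum p f ` polydisk)" by (rule bdd_aboveI2)
  with zero holomorphic_several_onI[of polydisk f c, OF der] show "f \<in> bloch_space p"
    by (simp add: bloch_space_def)
  show "bloch_norm p f \<le> norm (f 0) + A" by (rule bloch_norm_le[OF sum])
qed

lemma little_bloch_space_subset: "little_bloch_space p \<subseteq> bloch_space p"
proof -
  interpret Metric_space "bloch_space p" "norm_dist (bloch_space p) (bloch_norm p)"
    by (rule Metric_space_bloch)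
  show ?thesis
    using closure_of_subset_topspace[of mtopology] by (auto simp: little_bloch_space_def norm_topology_def)
qed

text \<open>One summand of \<open>bloch_quotient\<close>; necessity is proved for each pair
  \<open>(k, l)\<close> separately.\<close>

definition bloch_term ::
    "real \<Rightarrow> real \<Rightarrow> (complex ^ 'n \<Rightarrow> complex ^ 'n) \<Rightarrow> 'n \<Rightarrow> 'n \<Rightarrow> complex ^ 'n \<Rightarrow> real" where
  "bloch_term p q \<phi> k l z = norm (partial_deriv k (\<lambda>w. \<phi> w $ l) z) *
     ((1 - (norm (z $ k))\<^sup>2) powr q / (1 - (norm (\<phi> z $ l))\<^sup>2) powr p)"

lemma bloch_term_nonneg: "0 \<le> bloch_term p q \<phi> k l z"
  by (simp add: bloch_term_def)

lemma bloch_quotient_eq: "bloch_quotient p q \<phi> z = (\<Sum>k\<in>UNIV. \<Sum>l\<in>UNIV. bloch_term p q \<phi> k l z)"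
  by (simp add: bloch_quotient_def bloch_term_def)

lemma bloch_quotient_nonneg: "0 \<le> bloch_quotient p q \<phi> z"
  unfolding bloch_quotient_eq by (intro sum_nonneg bloch_term_nonneg)

section \<open>Test functions and necessity\<close>

lemma polynomial_in_little_bloch_space:
  assumes "f \<in> bloch_space p" "f \<in> polydisk_polynomials"
  shows "f \<in> little_bloch_space p"
proof -
  interpret Metric_space "bloch_space p" "norm_dist (bloch_space p) (bloch_norm p)"
    by (rule Metric_space_bloch)
  show ?thesis
    using assms closure_of_subset_Int[of mtopology polydisk_polynomials]
    by (auto simp: little_bloch_space_def norm_topology_def)
qed

text \<open>Compactness gives a subsequence of images converging in norm to some \<open>g\<close>.
  Norm convergence forces pointwise convergence, and the pointwise limit is 0, so \<open>g\<close>
  vanishes.\<close>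

lemma composition_op_null_subsequence:
  fixes F :: "nat \<Rightarrow> complex ^ 'n \<Rightarrow> complex"
  assumes comp: "compact_operator X N (bloch_space q) (bloch_norm q) (composition_op \<phi>)"
    and q: "0 \<le> q" and \<phi>: "\<phi> ` polydisk \<subseteq> polydisk"
    and F: "\<And>j. F j \<in> X" "\<And>j. N (F j) \<le> C"
    and null: "\<And>z. z \<in> polydisk \<Longrightarrow> (\<lambda>j. F j z) \<longlonglongrightarrow> 0"
  obtains r where "strict_mono r" "(\<lambda>j. bloch_norm q (composition_op \<phi> (F (r j)))) \<longlonglongrightarrow> 0"
proof -
  let ?T = "composition_op \<phi>"
  interpret Metric_space "bloch_space q" "norm_dist (bloch_space q) (bloch_norm q)"
    by (rule Metric_space_bloch)
  have TY: "?T (F j) \<in> bloch_space q" for j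
    using comp F(1) unfolding compact_operator_def by blast
  have "range F \<subseteq> X" "\<exists>C. \<forall>f\<in>range F. N f \<le> C" using F by auto
  then have "compactin mtopology (mtopology closure_of (?T ` range F))"
    using comp unfolding compact_operator_def norm_topology_def by blast
  moreover have "?T ` range F \<subseteq> mtopology closure_of (?T ` range F)"
    using TY by (intro closure_of_subset) auto
  then have "range (\<lambda>j. ?T (F j)) \<subseteq> mtopology closure_of (?T ` range F)" by auto
  ultimately obtain g r where r: "strict_mono (r :: nat \<Rightarrow> nat)"
    and lim: "limitin mtopology ((\<lambda>j. ?T (F j)) \<circ> r) g sequentially"
    unfolding compactin_sequentially by blast
  have g: "g \<in> bloch_space q"
    and "(\<lambda>j. norm_dist (bloch_space q) (bloch_norm q) (?T (F (r j))) g) \<longlonglongrightarrow> 0"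
    using lim unfolding limitin_metric_dist_null by (auto simp: o_def)
  then have lim0: "(\<lambda>j. bloch_norm q (\<lambda>z. ?T (F (r j)) z - g z)) \<longlonglongrightarrow> 0"
    by (simp add: norm_dist_def TY)
  \<comment> \<open>Inside the polydisk \<open>g z\<close> is the limit of
    \<open>F (r j) (\<phi> z)\<close>; outside it vanishes like every member of the Bloch
    space.\<close>
  have "g z = 0" for z
  proof (cases "z \<in> polydisk")
    case True
    obtain K where K: "\<And>f :: complex ^ 'n \<Rightarrow> complex. f \<in> bloch_space q \<Longrightarrow> norm (f z) \<le> K * bloch_norm q f"
      using bloch_pointwise_bound[OF q True] by blast
    have "(\<lambda>j. F (r j) (\<phi> z) - g z) \<longlonglongrightarrow> 0"
    proof (rule Lim_null_comparison[OF always_eventually])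
      show "\<forall>j. norm (F (r j) (\<phi> z) - g z) \<le> K * bloch_norm q (\<lambda>z. ?T (F (r j)) z - g z)"
        using K[OF bloch_space_diff(1)[OF TY g]] True by (simp add: composition_op_def)
      show "(\<lambda>j. K * bloch_norm q (\<lambda>z. ?T (F (r j)) z - g z)) \<longlonglongrightarrow> 0"
        using tendsto_mult_left[OF lim0, of K] by simp
    qed
    moreover have "(\<lambda>j. F (r j) (\<phi> z)) \<longlonglongrightarrow> 0"
      using LIMSEQ_subseq_LIMSEQ[OF null r, of "\<phi> z"] \<phi> True by (auto simp: o_def)
    ultimately have "(\<lambda>j. F (r j) (\<phi> z) - (F (r j) (\<phi> z) - g z)) \<longlonglongrightarrow> 0 - 0"
      by (intro tendsto_diff)
    then show "g z = 0" by (simp add: LIMSEQ_const_iff)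
  qed (use g in \<open>simp add: bloch_space_def\<close>)
  with lim0 r that show thesis by simp
qed

text \<open>The common core of both necessity arguments. At \<open>\<phi> (z j)\<close> only the
  \<open>l\<close>-th partial derivative of \<open>F j\<close> survives, so the \<open>k\<close>-th
  partial derivative of the composite is a single product, and \<open>c * \<epsilon>\<close> bounds
  all image norms from below. This contradicts the norm null subsequence.\<close>

lemma compact_composition_op_no_test_functions:
  fixes \<phi> :: "complex ^ 'n \<Rightarrow> complex ^ 'n"
  assumes comp: "compact_operator X (bloch_norm p) (bloch_space q) (bloch_norm q) (composition_op \<phi>)"
    and X: "X \<subseteq> bloch_space p" and q: "0 \<le> q" and \<phi>: "holomorphic_self_map \<phi>"
    and z: "\<And>j :: nat. z j \<in> polydisk" and \<epsilon>: "0 < \<epsilon>" "\<And>j. \<epsilon> \<le> bloch_term p q \<phi> k l (z j)"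
    and F: "\<And>j. F j \<in> X" "\<And>j. bloch_norm p (F j) \<le> C"
    and null: "\<And>x. x \<in> polydisk \<Longrightarrow> (\<lambda>j. F j x) \<longlonglongrightarrow> 0"
    and other: "\<And>i j. i \<noteq> l \<Longrightarrow> partial_deriv i (F j) (\<phi> (z j)) = 0"
    and c: "0 < c"
      "\<And>j. c \<le> norm (partial_deriv l (F j) (\<phi> (z j))) * (1 - (norm (\<phi> (z j) $ l))\<^sup>2) powr p"
  shows False
proof -
  let ?T = "composition_op \<phi>"
  have \<phi>U: "\<phi> ` polydisk \<subseteq> polydisk" using \<phi> by (simp add: holomorphic_self_map_def)
  obtain r where r: "strict_mono r" "(\<lambda>j. bloch_norm q (?T (F (r j)))) \<longlonglongrightarrow> 0"
    using composition_op_null_subsequence[OF comp q \<phi>U F null] .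
  have "c * \<epsilon> \<le> bloch_norm q (?T (F j))" for j
  proof -
    have "F j \<in> bloch_space p" using F(1) X by blast
    then have hol: "holomorphic_several_on (F j) polydisk" by (simp add: bloch_space_def)
    have w: "0 < 1 - (norm (\<phi> (z j) $ l))\<^sup>2" using \<phi>U z by (intro weight_pos) auto
    have "partial_deriv k (?T (F j)) (z j) =
        (\<Sum>i\<in>UNIV. partial_deriv i (F j) (\<phi> (z j)) * partial_deriv k (\<lambda>w. \<phi> w $ i) (z j))"
      by (rule partial_deriv_eqI[OF has_derivative_composition_op[OF \<phi> hol z]])
    also have "\<dots> = (\<Sum>i\<in>{l}. partial_deriv i (F j) (\<phi> (z j)) * partial_deriv k (\<lambda>w. \<phi> w $ i) (z j))"
      using other by (intro sum.mono_neutral_right) auto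
    finally have eq: "partial_deriv k (?T (F j)) (z j) =
        partial_deriv l (F j) (\<phi> (z j)) * partial_deriv k (\<lambda>w. \<phi> w $ l) (z j)" by simp
    have "c * \<epsilon> \<le> (norm (partial_deriv l (F j) (\<phi> (z j))) * (1 - (norm (\<phi> (z j) $ l))\<^sup>2) powr p) *
        bloch_term p q \<phi> k l (z j)"
      using c \<epsilon> by (intro mult_mono) auto
    also have "\<dots> = norm (partial_deriv k (?T (F j)) (z j)) * (1 - (norm (z j $ k))\<^sup>2) powr q"
      unfolding eq norm_mult bloch_term_def using w by (simp add: field_simps)
    also have "\<dots> \<le> bloch_norm q (?T (F j))"
      using comp F(1) z unfolding compact_operator_def by (intro partial_deriv_le_bloch_norm) auto
    finally show ?thesis .
  qed
  then have "c * \<epsilon> \<le> 0" by (intro LIMSEQ_le_const[OF r(2)]) auto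
  with c(1) \<epsilon>(1) show False by (simp add: mult_le_0_iff)
qed

section \<open>Test polynomials and their exponents\<close>

text \<open>With \<open>x = (M + 1) (1 - r)\<close> this is the boundedness of \<open>x\<^sup>p exp (- x)\<close>.\<close>

lemma power_weight_bound:
  fixes r p :: real
  assumes r: "0 \<le> r" "r < 1" and p: "0 < p"
  shows "real (Suc M) powr p * r ^ M * (1 - r\<^sup>2) powr p \<le> exp 1 * (2 * p) powr p"
proof -
  define x where "x = real (Suc M) * (1 - r)"
  have x: "0 \<le> x" using r by (simp add: x_def)
  have r2: "0 \<le> 1 - r\<^sup>2" using r abs_square_le_1[of r] by simp
  have "1 - r\<^sup>2 = (1 - r) * (1 + r)" by (simp add: power2_eq_square algebra_simps)
  also have "\<dots> \<le> (1 - r) * 2" using r by (intro mult_left_mono) auto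
  finally have "real (Suc M) * (1 - r\<^sup>2) \<le> 2 * x"
    unfolding x_def by (metis mult.assoc mult.commute mult_left_mono of_nat_0_le_iff)
  \<comment> \<open>The scale \<open>x / p\<close> is chosen so that the \<open>p\<close>-th power
    yields exactly \<open>exp x\<close>, which the decay of \<open>r ^ M\<close> cancels
    below.\<close>
  also have "x / p \<le> exp (x / p)" using exp_ge_add_one_self[of "x / p"] by linarith
  then have "2 * x \<le> 2 * p * exp (x / p)" using p by (simp add: field_simps)
  finally have "(real (Suc M) * (1 - r\<^sup>2)) powr p \<le> (2 * p * exp (x / p)) powr p"
    using p r2 by (intro powr_mono2) auto
  also have "\<dots> = (2 * p) powr p * exp x"
    using p by (simp add: powr_mult exp_powr_real)
  finally have 1: "(real (Suc M) * (1 - r\<^sup>2)) powr p \<le> (2 * p) powr p * exp x" .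
  \<comment> \<open>The exponent is \<open>M\<close>, while \<open>x\<close> contains
    \<open>Suc M\<close>; the discrepancy \<open>1 - r\<close> accounts for the factor
    \<open>exp 1\<close> in the bound.\<close>
  have "r \<le> exp (r - 1)" using exp_ge_add_one_self[of "r - 1"] by simp
  then have "r ^ M \<le> exp (r - 1) ^ M" using r by (intro power_mono) auto
  also have "\<dots> = exp (1 - r - x)"
    unfolding x_def by (simp add: exp_of_nat_mult[symmetric] algebra_simps)
  also have "\<dots> \<le> exp (1 - x)" using r by simp
  finally have 2: "r ^ M \<le> exp (1 - x)" .
  have "(real (Suc M) * (1 - r\<^sup>2)) powr p * r ^ M \<le> ((2 * p) powr p * exp x) * exp (1 - x)"
    using r by (intro mult_mono 1 2) auto
  also have "\<dots> = exp 1 * (2 * p) powr p" by (simp add: exp_diff)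
  finally show ?thesis using r2 by (simp add: powr_mult mult_ac)
qed

text \<open>The exponent of the test functions is \<open>M = \<lfloor>1 / (2 s)\<rfloor>\<close> for \<open>s = 1 - t\<^sup>2\<close>, \<open>t = \<bar>w\<^sub>m\<bar>\<close>; the lower bound
  for \<open>t\<^sup>M\<close> is Bernoulli's inequality.\<close>

lemma test_exponent:
  fixes t :: real
  assumes t: "t < 1" "1 - t < 1 / (4 * real (Suc j))"
  obtains M where "j \<le> M" "1/2 \<le> t" "1/2 \<le> t ^ M" "1/2 \<le> real (Suc M) * (1 - t\<^sup>2)"
proof -
  define s where "s = 1 - t\<^sup>2"
  have "1 / (4 * real (Suc j)) \<le> 1 / 4" by (simp add: field_simps)
  then have t2: "3/4 < t" using t by linarith
  then have s0: "0 < s" using t abs_square_less_1[of t] by (simp add: s_def)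
  have "s = (1 - t) * (1 + t)" by (simp add: s_def power2_eq_square algebra_simps)
  also have "\<dots> \<le> (1 - t) * 2" using t by (intro mult_left_mono) auto
  also have "\<dots> < 1 / (4 * real (Suc j)) * 2" using t by simp
  finally have sj: "s < 1 / (2 * real (Suc j))" by (simp add: field_simps)
  define M where "M = nat \<lfloor>1 / (2 * s)\<rfloor>"
  have "real (Suc j) \<le> 1 / (2 * s)" using sj s0 by (simp add: field_simps)
  then have "int (Suc j) \<le> \<lfloor>1 / (2 * s)\<rfloor>" by (simp add: le_floor_iff)
  then have jM: "j \<le> M" unfolding M_def by linarith
  have MR: "real M = of_int \<lfloor>1 / (2 * s)\<rfloor>" unfolding M_def using s0 by simp
  have "real M \<le> 1 / (2 * s)" "1 / (2 * s) < real (Suc M)" unfolding of_nat_Suc MR by linarith+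
  then have M: "real M * s \<le> 1/2" "1/2 \<le> real (Suc M) * s" using s0 by (simp_all add: field_simps)
  have "1/2 \<le> 1 + real M * (- s)" using M by simp
  also have "\<dots> \<le> (1 + (- s)) ^ M"
    by (rule Bernoulli_inequality) (use t2 t in \<open>simp add: s_def power2_eq_square\<close>)
  also have "\<dots> = (t * t) ^ M" by (simp add: s_def power2_eq_square)
  also have "\<dots> \<le> t ^ M" using t t2 by (intro power_mono) (auto simp: mult_le_one mult_left_le)
  finally have "1/2 \<le> t ^ M" .
  with jM t2 M(2) show thesis by (intro that[of M]) (auto simp: s_def)
qed

text \<open>The scalar \<open>real (Suc M) powr (p - 1)\<close> turns the derivative into
  \<open>real (Suc M) powr p\<close> times the \<open>M\<close>-th power of \<open>z $ l\<close>,
  which is what \<open>power_weight_bound\<close> controls, uniformly in \<open>M\<close>.\<close>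

lemma monomial_test_function:
  fixes l :: "'n::finite"
  assumes p: "0 < p"
  defines "F \<equiv> \<lambda>M (z :: complex ^ 'n). if z \<in> polydisk
      then complex_of_real (real (Suc M) powr (p - 1)) * (z $ l) ^ Suc M else 0"
  shows "F M \<in> little_bloch_space p" (is ?little)
    and "bloch_norm p (F M) \<le> exp 1 * (2 * p) powr p" (is ?norm)
    and "z \<in> polydisk \<Longrightarrow> partial_deriv k (F M) z =
      (if k = l then complex_of_real (real (Suc M) powr p) * (z $ l) ^ M else 0)"
proof -
  define c where "c z k = (if k = l then complex_of_real (real (Suc M) powr p) * (z $ l) ^ M else 0)"
    for z :: "complex ^ 'n" and k
  have der: "(F M has_derivative (\<lambda>v. \<Sum>k\<in>UNIV. c z k * v $ k)) (at z)" if "z \<in> polydisk" for z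
  proof (rule has_derivative_transform_polydisk[OF _ that])
    have nat: "real (Suc M) powr p = real (Suc M) powr (p - 1) * real (Suc M)"
      by (simp add: powr_diff)
    have *: "(\<Sum>k\<in>UNIV. c z k * v $ k) = complex_of_real (real (Suc M) powr (p - 1)) *
        (of_nat (Suc M) * (v $ l * (z $ l) ^ M))" for v
    proof -
      have "(\<Sum>k\<in>UNIV. c z k * v $ k) = (\<Sum>k\<in>{l}. c z k * v $ k)"
        by (rule sum.mono_neutral_right) (auto simp: c_def)
      then show ?thesis unfolding c_def nat by (simp add: mult_ac)
    qed
    have nth: "((\<lambda>w :: complex ^ 'n. w $ l) has_derivative (\<lambda>v. v $ l)) (at z)"
      by (rule bounded_linear_imp_has_derivative[OF bounded_linear_vec_nth])
    show "((\<lambda>w. complex_of_real (real (Suc M) powr (p - 1)) * (w $ l) ^ Suc M) has_derivative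
        (\<lambda>v. \<Sum>k\<in>UNIV. c z k * v $ k)) (at z)"
      unfolding * using has_derivative_mult_right[OF has_derivative_power[OF nth, where n = "Suc M"],
        where x = "complex_of_real (real (Suc M) powr (p - 1))"]
      by (simp add: mult_ac)
  qed (simp add: F_def)
  have le: "(\<Sum>k\<in>UNIV. norm (c z k) * (1 - (norm (z $ k))\<^sup>2) powr p) \<le> exp 1 * (2 * p) powr p"
    if "z \<in> polydisk" for z
  proof -
    have "(\<Sum>k\<in>UNIV. norm (c z k) * (1 - (norm (z $ k))\<^sup>2) powr p) =
        (\<Sum>k\<in>{l}. norm (c z k) * (1 - (norm (z $ k))\<^sup>2) powr p)"
      by (rule sum.mono_neutral_right) (auto simp: c_def)
    also have "\<dots> \<le> exp 1 * (2 * p) powr p"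
      using power_weight_bound[of "norm (z $ l)" p M] that p
      by (simp add: c_def norm_mult norm_power polydisk_def del: of_nat_Suc)
    finally show ?thesis .
  qed
  have F0: "F M z = 0" if "z \<notin> polydisk" for z using that by (simp add: F_def)
  note bl = bloch_spaceI[OF der le F0]
  have "F M \<in> polydisk_polynomials"
    unfolding polydisk_polynomials_def
  proof (intro CollectI exI conjI)
    show "finite {\<lambda>i. if i = l then Suc M else 0}" by simp
    show "F M = (\<lambda>z. if z \<in> polydisk then \<Sum>\<alpha>\<in>{\<lambda>i. if i = l then Suc M else 0}.
        complex_of_real (real (Suc M) powr (p - 1)) * (\<Prod>i\<in>UNIV. (z $ i) ^ \<alpha> i) else 0)"
      by (simp add: F_def if_distrib[of "power _"] fun_eq_iff cong: if_cong)
  qed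
  with bl(1) show ?little by (rule polynomial_in_little_bloch_space)
  have "F M 0 = 0" by (simp add: F_def)
  then show ?norm using bl(2) by simp
  show "partial_deriv k (F M) z =
      (if k = l then complex_of_real (real (Suc M) powr p) * (z $ l) ^ M else 0)" if "z \<in> polydisk"
    using partial_deriv_eqI[OF der[OF that]] by (simp add: c_def)
qed

text \<open>With \<open>a\<close> the \<open>l\<close>-th coordinate of the test point, the factor
  \<open>z $ l - a\<close> annihilates the \<open>m\<close>-th partial derivative there and leaves a
  pure power of \<open>z $ m\<close> in direction \<open>l\<close>. The norm bound is uniform in
  both \<open>a\<close> and \<open>M\<close>.\<close>

lemma mixed_test_function:
  fixes l m :: "'n::finite" and a :: complex
  assumes p: "1 \<le> p" and lm: "l \<noteq> m" and a: "norm a \<le> 1"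
  defines "F \<equiv> \<lambda>M (z :: complex ^ 'n). if z \<in> polydisk then (z $ l - a) * (z $ m) ^ Suc M else 0"
  shows "F M \<in> little_bloch_space p" (is ?little)
    and "bloch_norm p (F M) \<le> 1 + 2 * (exp 1 * (2 * p) powr p)" (is ?norm)
    and "z \<in> polydisk \<Longrightarrow> partial_deriv k (F M) z =
      (if k = l then (z $ m) ^ Suc M
       else if k = m then (z $ l - a) * (of_nat (Suc M) * (z $ m) ^ M) else 0)"
proof -
  define c where "c z k = (if k = l then (z $ m) ^ Suc M
       else if k = m then (z $ l - a) * (of_nat (Suc M) * (z $ m) ^ M) else 0)"
    for z :: "complex ^ 'n" and k
  have sum: "(\<Sum>k\<in>UNIV. h k) = h l + h m" if "\<And>k. k \<noteq> l \<Longrightarrow> k \<noteq> m \<Longrightarrow> h k = 0"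
    for h :: "'n \<Rightarrow> 'b::comm_monoid_add"
  proof -
    have "(\<Sum>k\<in>UNIV. h k) = (\<Sum>k\<in>{l, m}. h k)" using that by (intro sum.mono_neutral_right) auto
    with lm show ?thesis by simp
  qed
  have der: "(F M has_derivative (\<lambda>v. \<Sum>k\<in>UNIV. c z k * v $ k)) (at z)" if "z \<in> polydisk" for z
  proof (rule has_derivative_transform_polydisk[OF _ that])
    have *: "(\<Sum>k\<in>UNIV. c z k * v $ k) =
        (z $ l - a) * (of_nat (Suc M) * (v $ m) * (z $ m) ^ M) + v $ l * (z $ m) ^ Suc M" for v
      using lm by (subst sum) (auto simp: c_def)
    have nth: "((\<lambda>w :: complex ^ 'n. w $ i) has_derivative (\<lambda>v. v $ i)) (at z)" for i
      by (rule bounded_linear_imp_has_derivative[OF bounded_linear_vec_nth])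
    have "((\<lambda>w. w $ l - a) has_derivative (\<lambda>v. v $ l)) (at z)"
      using has_derivative_diff[OF nth has_derivative_const] by simp
    from has_derivative_mult[OF this has_derivative_power[OF nth, where n = "Suc M"]]
    show "((\<lambda>w. (w $ l - a) * (w $ m) ^ Suc M) has_derivative (\<lambda>v. \<Sum>k\<in>UNIV. c z k * v $ k)) (at z)"
      unfolding * by simp
  qed (simp add: F_def)
  have le: "(\<Sum>k\<in>UNIV. norm (c z k) * (1 - (norm (z $ k))\<^sup>2) powr p) \<le> 1 + 2 * (exp 1 * (2 * p) powr p)"
    if z: "z \<in> polydisk" for z
  proof -
    have z1: "norm (z $ i) < 1" for i using z by (simp add: polydisk_def)
    have "norm (c z l) * (1 - (norm (z $ l))\<^sup>2) powr p \<le> 1 * 1"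
      using z1[of m] weight_le_1[OF z, of p l] p
      by (intro mult_mono) (auto simp: c_def norm_mult norm_power intro!: mult_le_one power_le_one)
    moreover have "norm (c z m) * (1 - (norm (z $ m))\<^sup>2) powr p \<le> 2 * (exp 1 * (2 * p) powr p)"
    proof -
      have "norm (z $ l - a) \<le> 2" using norm_triangle_ineq4[of "z $ l" a] a z1[of l] by linarith
      \<comment> \<open>Here \<open>p \<ge> 1\<close> enters: the derivative of the power
        contributes \<open>Suc M\<close>, which must be dominated by
        \<open>real (Suc M) powr p\<close>.\<close>
      moreover have "real (Suc M) powr 1 \<le> real (Suc M) powr p"
        using p by (intro powr_mono) auto
      then have "real (Suc M) * norm (z $ m) ^ M * (1 - (norm (z $ m))\<^sup>2) powr p \<le>
          real (Suc M) powr p * norm (z $ m) ^ M * (1 - (norm (z $ m))\<^sup>2) powr p"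
        by (intro mult_right_mono) auto
      then have "real (Suc M) * norm (z $ m) ^ M * (1 - (norm (z $ m))\<^sup>2) powr p \<le> exp 1 * (2 * p) powr p"
        using power_weight_bound[of "norm (z $ m)" p M] z1[of m] p by simp
      ultimately have "norm (z $ l - a) * (real (Suc M) * norm (z $ m) ^ M * (1 - (norm (z $ m))\<^sup>2) powr p)
          \<le> 2 * (exp 1 * (2 * p) powr p)"
        by (rule mult_mono) auto
      then show ?thesis using lm by (simp add: c_def norm_mult norm_power mult_ac del: of_nat_Suc)
    qed
    ultimately show ?thesis by (subst sum) (auto simp: c_def)
  qed
  have F0: "F M z = 0" if "z \<notin> polydisk" for z using that by (simp add: F_def)
  note bl = bloch_spaceI[OF der le F0]
  \<comment> \<open>Exponents of the two monomials of the expanded product. They differ since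
    \<open>l \<noteq> m\<close>, so the sum over \<open>{\<alpha>, \<beta>}\<close> really has two
    terms.\<close>
  define \<alpha> \<beta> where "\<alpha> = (\<lambda>i. (if i = l then 1 else 0) + (if i = m then Suc M else 0))"
    and "\<beta> = (\<lambda>i. if i = m then Suc M else 0)"
  have "\<alpha> l \<noteq> \<beta> l" using lm by (simp add: \<alpha>_def \<beta>_def)
  then have ne: "\<alpha> \<noteq> \<beta>" by auto
  have \<alpha>: "(\<Prod>i\<in>UNIV. (z $ i) ^ \<alpha> i) = z $ l * (z $ m) ^ Suc M" for z :: "complex ^ 'n"
    unfolding power_add prod.distrib \<alpha>_def by (simp add: if_distrib[of "power _"] cong: if_cong)
  have \<beta>: "(\<Prod>i\<in>UNIV. (z $ i) ^ \<beta> i) = (z $ m) ^ Suc M" for z :: "complex ^ 'n"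
    unfolding \<beta>_def by (simp add: if_distrib[of "power _"] cong: if_cong)
  have "F M \<in> polydisk_polynomials"
    unfolding polydisk_polynomials_def
  proof (intro CollectI exI conjI)
    show "finite {\<alpha>, \<beta>}" by simp
    show "F M = (\<lambda>z. if z \<in> polydisk then \<Sum>\<gamma>\<in>{\<alpha>, \<beta>}.
        (if \<gamma> = \<alpha> then 1 else - a) * (\<Prod>i\<in>UNIV. (z $ i) ^ \<gamma> i) else 0)"
      unfolding F_def using ne ne[symmetric] by (auto simp: fun_eq_iff \<alpha> \<beta> left_diff_distrib)
  qed
  with bl(1) show ?little by (rule polynomial_in_little_bloch_space)
  have "F M 0 = 0" by (simp add: F_def)
  then show ?norm using bl(2) by simp
  show "partial_deriv k (F M) z = (if k = l then (z $ m) ^ Suc M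
       else if k = m then (z $ l - a) * (of_nat (Suc M) * (z $ m) ^ M) else 0)" if "z \<in> polydisk"
    using partial_deriv_eqI[OF der[OF that]] by (simp add: c_def)
qed

section \<open>Decay of the single terms at the boundary\<close>

text \<open>Otherwise there are points \<open>z j\<close> with the term at least
  \<open>\<epsilon>\<close> and \<open>\<phi> (z j) $ l\<close> approaching the unit circle.
  Monomials whose exponents are matched to these moduli violate the preceding obstruction.\<close>

lemma bloch_term_small_same:
  fixes \<phi> :: "complex ^ 'n \<Rightarrow> complex ^ 'n"
  assumes comp: "compact_operator (little_bloch_space p) (bloch_norm p) (bloch_space q) (bloch_norm q)
      (composition_op \<phi>)"
    and p: "0 < p" and q: "0 \<le> q" and \<phi>: "holomorphic_self_map \<phi>" and \<epsilon>: "0 < \<epsilon>"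
  shows "\<exists>\<delta>>0. \<forall>z\<in>polydisk. 1 - norm (\<phi> z $ l) < \<delta> \<longrightarrow> bloch_term p q \<phi> k l z < \<epsilon>"
proof (rule ccontr)
  assume contr: "\<not> ?thesis"
  \<comment> \<open>These radii are the ones demanded by \<open>test_exponent\<close>, which then
    supplies exponents at least \<open>j\<close>.\<close>
  have "\<exists>z\<in>polydisk. 1 - norm (\<phi> z $ l) < 1 / (4 * real (Suc j)) \<and> \<epsilon> \<le> bloch_term p q \<phi> k l z" for j
  proof -
    have "0 < 1 / (4 * real (Suc j))" by simp
    with contr show ?thesis by (meson not_le)
  qed
  then obtain z where z: "\<And>j. z j \<in> polydisk" "\<And>j. 1 - norm (\<phi> (z j) $ l) < 1 / (4 * real (Suc j))"
      "\<And>j. \<epsilon> \<le> bloch_term p q \<phi> k l (z j)"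
    by metis
  have \<phi>z: "\<phi> (z j) \<in> polydisk" for j using \<phi> z(1) by (auto simp: holomorphic_self_map_def)
  then have w: "norm (\<phi> (z j) $ l) < 1" for j by (simp add: polydisk_def)
  have "\<exists>M\<ge>j. 1/2 \<le> norm (\<phi> (z j) $ l) ^ M \<and> 1/2 \<le> real (Suc M) * (1 - (norm (\<phi> (z j) $ l))\<^sup>2)" for j
    using test_exponent[OF w z(2), of j] by metis
  then obtain M where M: "\<And>j. j \<le> M j" "\<And>j. 1/2 \<le> norm (\<phi> (z j) $ l) ^ M j"
      "\<And>j. 1/2 \<le> real (Suc (M j)) * (1 - (norm (\<phi> (z j) $ l))\<^sup>2)"
    by metis
  define F where "F M = (\<lambda>z :: complex ^ 'n. if z \<in> polydisk
      then complex_of_real (real (Suc M) powr (p - 1)) * (z $ l) ^ Suc M else 0)" for M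
  note F = monomial_test_function[OF p, where l = l, folded F_def]
  show False
  proof (rule compact_composition_op_no_test_functions[OF comp little_bloch_space_subset q \<phi> z(1) \<epsilon> z(3),
        where F = "\<lambda>j. F (M j)"])
    show "F (M j) \<in> little_bloch_space p" for j by (rule F)
    show "bloch_norm p (F (M j)) \<le> exp 1 * (2 * p) powr p" for j by (rule F)
    show "partial_deriv i (F (M j)) (\<phi> (z j)) = 0" if "i \<noteq> l" for i j
      using that F(3)[OF \<phi>z] by simp
    \<comment> \<open>The first factor comes from \<open>real (Suc (M j))\<close> times the weight
      base being at least 1/2, the second from the lower bound on the \<open>M j\<close>-th
      power.\<close>
    show "0 < (1/2) powr p * (1/2 :: real)" by simp
    show "(1/2) powr p * (1/2) \<le>
        norm (partial_deriv l (F (M j)) (\<phi> (z j))) * (1 - (norm (\<phi> (z j) $ l))\<^sup>2) powr p" for j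
    proof -
      have "(1/2) powr p * (1/2) \<le>
          (real (Suc (M j)) * (1 - (norm (\<phi> (z j) $ l))\<^sup>2)) powr p * norm (\<phi> (z j) $ l) ^ M j"
        using M(2,3) p by (intro mult_mono powr_mono2) auto
      also have "\<dots> = norm (partial_deriv l (F (M j)) (\<phi> (z j))) * (1 - (norm (\<phi> (z j) $ l))\<^sup>2) powr p"
        using weight_pos[OF \<phi>z]
        by (simp add: F(3)[OF \<phi>z] norm_mult norm_power powr_mult less_imp_le del: of_nat_Suc)
      finally show ?thesis .
    qed
    show "(\<lambda>j. F (M j) x) \<longlonglongrightarrow> 0" if x: "x \<in> polydisk" for x
    proof (rule Lim_null_comparison[OF always_eventually])
      \<comment> \<open>For fixed \<open>x\<close>, \<open>power_weight_bound\<close> keeps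
        \<open>real (Suc M) powr p * norm (x $ l) ^ M\<close> below \<open>K\<close>. The test
        function has exponent \<open>p - 1\<close> instead of \<open>p\<close>, and the factor
        \<open>1 / real (Suc (M j))\<close> gained this way forces convergence to 0.\<close>
      define K where "K = exp 1 * (2 * p) powr p / (1 - (norm (x $ l))\<^sup>2) powr p"
      have wx: "0 < (1 - (norm (x $ l))\<^sup>2) powr p" using weight_pos[OF x, of l] by simp
      have "norm (F (M j) x) \<le> K * (1 / real (Suc j))" for j
      proof -
        have xl: "norm (x $ l) < 1" using x by (simp add: polydisk_def)
        have "norm (F (M j) x) = real (Suc (M j)) powr p * norm (x $ l) ^ M j / real (Suc (M j)) * norm (x $ l)"
          using x by (simp add: F_def norm_mult norm_power norm_divide powr_diff norm_of_nat del: of_nat_Suc)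
        also have "\<dots> \<le> real (Suc (M j)) powr p * norm (x $ l) ^ M j / real (Suc (M j))"
          using xl by (intro mult_left_le) auto
        also have "real (Suc (M j)) powr p * norm (x $ l) ^ M j \<le> K"
          using power_weight_bound[OF norm_ge_zero xl p, of "M j"] wx by (simp add: K_def field_simps)
        then have "real (Suc (M j)) powr p * norm (x $ l) ^ M j / real (Suc (M j)) \<le> K / real (Suc j)"
          using M(1)[of j] wx by (intro frac_le) (auto simp: K_def)
        finally show ?thesis by simp
      qed
      then show "\<forall>j. norm (F (M j) x) \<le> K * (1 / real (Suc j))" ..
      show "(\<lambda>j. K * (1 / real (Suc j))) \<longlonglongrightarrow> 0"
        using tendsto_mult_left[OF LIMSEQ_inverse_real_of_nat, of K] by (simp add: inverse_eq_divide)
    qed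
  qed
qed

text \<open>Exponents are now matched to the \<open>m\<close>-th coordinate, and the test functions
  are the mixed ones centred at \<open>\<phi> (z j) $ l\<close>. The weight in the
  \<open>l\<close>-th coordinate stays away from 0, because the previous lemma already handles
  points where that coordinate is near the unit circle.\<close>

lemma bloch_term_small_other:
  fixes \<phi> :: "complex ^ 'n \<Rightarrow> complex ^ 'n"
  assumes comp: "compact_operator (little_bloch_space p) (bloch_norm p) (bloch_space q) (bloch_norm q)
      (composition_op \<phi>)"
    and p: "1 \<le> p" and q: "0 \<le> q" and \<phi>: "holomorphic_self_map \<phi>" and \<epsilon>: "0 < \<epsilon>"
    and lm: "l \<noteq> m"
  shows "\<exists>\<delta>>0. \<forall>z\<in>polydisk. 1 - norm (\<phi> z $ m) < \<delta> \<longrightarrow> bloch_term p q \<phi> k l z < \<epsilon>"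
proof (rule ccontr)
  assume contr: "\<not> ?thesis"
  have "\<exists>z\<in>polydisk. 1 - norm (\<phi> z $ m) < 1 / (4 * real (Suc j)) \<and> \<epsilon> \<le> bloch_term p q \<phi> k l z" for j
  proof -
    have "0 < 1 / (4 * real (Suc j))" by simp
    with contr show ?thesis by (meson not_le)
  qed
  then obtain z where z: "\<And>j. z j \<in> polydisk" "\<And>j. 1 - norm (\<phi> (z j) $ m) < 1 / (4 * real (Suc j))"
      "\<And>j. \<epsilon> \<le> bloch_term p q \<phi> k l (z j)"
    by metis
  have \<phi>z: "\<phi> (z j) \<in> polydisk" for j using \<phi> z(1) by (auto simp: holomorphic_self_map_def)
  then have w: "norm (\<phi> (z j) $ i) < 1" for i j by (simp add: polydisk_def)
  have "\<exists>M\<ge>j. 1/2 \<le> norm (\<phi> (z j) $ m) \<and> 1/2 \<le> norm (\<phi> (z j) $ m) ^ M" for j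
    using test_exponent[OF w z(2), of j] by metis
  then obtain M where M: "\<And>j. j \<le> M j" "\<And>j. 1/2 \<le> norm (\<phi> (z j) $ m)"
      "\<And>j. 1/2 \<le> norm (\<phi> (z j) $ m) ^ M j"
    by metis
  obtain \<delta> where \<delta>: "0 < \<delta>"
      "\<And>z. z \<in> polydisk \<Longrightarrow> 1 - norm (\<phi> z $ l) < \<delta> \<Longrightarrow> bloch_term p q \<phi> k l z < \<epsilon>"
    using bloch_term_small_same[OF comp _ q \<phi> \<epsilon>, of l k] p by auto
  define F where "F a M = (\<lambda>z :: complex ^ 'n. if z \<in> polydisk then (z $ l - a) * (z $ m) ^ Suc M else 0)"
    for a M
  note F = mixed_test_function[OF p lm, folded F_def]
  let ?F = "\<lambda>j. F (\<phi> (z j) $ l) (M j)"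
  show False
  proof (rule compact_composition_op_no_test_functions[OF comp little_bloch_space_subset q \<phi> z(1) \<epsilon> z(3),
        where F = ?F])
    show "?F j \<in> little_bloch_space p" for j by (rule F(1)[OF less_imp_le[OF w]])
    show "bloch_norm p (?F j) \<le> 1 + 2 * (exp 1 * (2 * p) powr p)" for j
      by (rule F(2)[OF less_imp_le[OF w]])
    show "partial_deriv i (?F j) (\<phi> (z j)) = 0" if "i \<noteq> l" for i j
      using that F(3)[OF less_imp_le[OF w] \<phi>z] by simp
    \<comment> \<open>The power with exponent \<open>Suc (M j)\<close> is at least
      \<open>1/2 * 1/2\<close>, the extra factor being the modulus itself; the weight is at least
      \<open>\<delta> powr p\<close>.\<close>
    show "0 < 1/4 * \<delta> powr p" using \<delta> by simp
    show "1/4 * \<delta> powr p \<le>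
        norm (partial_deriv l (?F j) (\<phi> (z j))) * (1 - (norm (\<phi> (z j) $ l))\<^sup>2) powr p" for j
    proof -
      let ?t = "norm (\<phi> (z j) $ l)"
      have "\<delta> \<le> 1 - ?t" using \<delta>(2)[OF z(1)] z(3)[of j] by (meson not_le)
      moreover have "?t\<^sup>2 \<le> ?t" using w[of j l] by (simp add: power2_eq_square mult_left_le)
      ultimately have "\<delta> \<le> 1 - ?t\<^sup>2" by linarith
      moreover have "(1/2 * (1/2) :: real) \<le> norm (\<phi> (z j) $ m) * norm (\<phi> (z j) $ m) ^ M j"
        using M(2,3)[of j] by (intro mult_mono) auto
      ultimately have "1/4 * \<delta> powr p \<le> (norm (\<phi> (z j) $ m) * norm (\<phi> (z j) $ m) ^ M j) * (1 - ?t\<^sup>2) powr p"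
        using \<delta>(1) p by (intro mult_mono powr_mono2) auto
      then show ?thesis by (simp add: F(3)[OF less_imp_le[OF w] \<phi>z] norm_mult norm_power)
    qed
    show "(\<lambda>j. ?F j x) \<longlonglongrightarrow> 0" if x: "x \<in> polydisk" for x
    proof (rule Lim_null_comparison[OF always_eventually])
      have x1: "norm (x $ i) < 1" for i using x by (simp add: polydisk_def)
      have "norm (?F j x) \<le> 2 * norm (x $ m) ^ j" for j
      proof -
        have "norm (x $ l - \<phi> (z j) $ l) \<le> 2"
          using norm_triangle_ineq4[of "x $ l" "\<phi> (z j) $ l"] x1[of l] w[of j l] by linarith
        moreover have "norm (x $ m) ^ Suc (M j) \<le> norm (x $ m) ^ j"
          using M(1)[of j] x1[of m] by (intro power_decreasing) auto
        ultimately have "norm (x $ l - \<phi> (z j) $ l) * norm (x $ m) ^ Suc (M j) \<le> 2 * norm (x $ m) ^ j"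
          by (intro mult_mono) auto
        then show ?thesis using x by (simp add: F_def norm_mult norm_power)
      qed
      then show "\<forall>j. norm (?F j x) \<le> 2 * norm (x $ m) ^ j" ..
      show "(\<lambda>j. 2 * norm (x $ m) ^ j) \<longlonglongrightarrow> 0"
        using tendsto_mult_left[OF LIMSEQ_power_zero[of "norm (x $ m)"], of 2] x1[of m] by simp
    qed
  qed
qed

lemma compact_imp_tendsto_zero_at_boundary:
  fixes \<phi> :: "complex ^ 'n \<Rightarrow> complex ^ 'n"
  assumes comp: "compact_operator (little_bloch_space p) (bloch_norm p) (bloch_space q) (bloch_norm q)
      (composition_op \<phi>)"
    and p: "1 \<le> p" and q: "0 \<le> q" and \<phi>: "holomorphic_self_map \<phi>"
  shows "tendsto_zero_at_boundary \<phi> (bloch_quotient p q \<phi>)"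
  unfolding tendsto_zero_at_boundary_def
proof (intro allI impI)
  fix \<epsilon> :: real assume \<epsilon>: "0 < \<epsilon>"
  \<comment> \<open>There are \<open>n * n\<close> terms; halving the share of each makes the final
    inequality strict.\<close>
  define n where "n = real CARD('n)"
  have n: "0 < n" by (simp add: n_def)
  then have \<epsilon>n: "0 < \<epsilon> / (n * n) / 2" using \<epsilon> by simp
  define d where "d k l m = (SOME \<delta>. 0 < \<delta> \<and> (\<forall>z\<in>polydisk.
      1 - norm (\<phi> z $ m) < \<delta> \<longrightarrow> bloch_term p q \<phi> k l z < \<epsilon> / (n * n) / 2))" for k l m
  have d: "0 < d k l m \<and> (\<forall>z\<in>polydisk.
      1 - norm (\<phi> z $ m) < d k l m \<longrightarrow> bloch_term p q \<phi> k l z < \<epsilon> / (n * n) / 2)" for k l m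
    unfolding d_def
  proof (rule someI_ex, cases "l = m")
    case True
    then show "\<exists>\<delta>>0. \<forall>z\<in>polydisk. 1 - norm (\<phi> z $ m) < \<delta> \<longrightarrow> bloch_term p q \<phi> k l z < \<epsilon> / (n * n) / 2"
      using bloch_term_small_same[OF comp _ q \<phi> \<epsilon>n, of m k] p by simp
  next
    case False
    show "\<exists>\<delta>>0. \<forall>z\<in>polydisk. 1 - norm (\<phi> z $ m) < \<delta> \<longrightarrow> bloch_term p q \<phi> k l z < \<epsilon> / (n * n) / 2"
      by (rule bloch_term_small_other[OF comp p q \<phi> \<epsilon>n False])
  qed
  \<comment> \<open>Closeness to the boundary only says that some coordinate \<open>m\<close> is
    near the unit circle, so one radius must serve all triples \<open>(k, l, m)\<close>.\<close>
  define \<delta> where "\<delta> = Min (range (\<lambda>(k, l, m). d k l m))"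
  have \<delta>d: "\<delta> \<le> d k l m" for k l m
    unfolding \<delta>_def by (rule Min_le) (auto intro!: image_eqI[of _ _ "(k, l, m)"])
  have "\<delta> \<in> range (\<lambda>(k, l, m). d k l m)" unfolding \<delta>_def by (rule Min_in) auto
  then have "0 < \<delta>" using d by auto
  moreover have "\<bar>bloch_quotient p q \<phi> z\<bar> < \<epsilon>"
    if z: "z \<in> polydisk" and dist: "infdist (\<phi> z) (frontier polydisk) < \<delta>" for z
  proof -
    obtain m where m: "1 - norm (\<phi> z $ m) < \<delta>" using infdist_frontier_polydisk_less[OF dist] .
    have "bloch_term p q \<phi> k l z \<le> \<epsilon> / (n * n) / 2" for k l
      using d[of k l m] z less_le_trans[OF m \<delta>d] by (blast intro: less_imp_le)
    then have "bloch_quotient p q \<phi> z \<le> (\<Sum>k\<in>(UNIV::'n set). \<Sum>l\<in>(UNIV::'n set). \<epsilon> / (n * n) / 2)"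
      unfolding bloch_quotient_eq by (intro sum_mono)
    also have "\<dots> = \<epsilon> / 2" using n by (simp add: n_def[symmetric])
    finally show ?thesis
      using \<epsilon> bloch_term_nonneg[of p q \<phi>] by (simp add: bloch_quotient_eq sum_nonneg)
  qed
  ultimately show "\<exists>\<delta>>0. \<forall>z\<in>polydisk. infdist (\<phi> z) (frontier polydisk) < \<delta> \<longrightarrow> \<bar>bloch_quotient p q \<phi> z\<bar> < \<epsilon>"
    by blast
qed

section \<open>Normal families and sufficiency\<close>

text \<open>Varying the \<open>k\<close>-th coordinate within distance \<open>t - s\<close> stays in
  the larger closed polydisk, so the one-variable Cauchy inequality applies to the slice.\<close>

lemma partial_deriv_cauchy_estimate:
  fixes h :: "complex ^ 'n \<Rightarrow> complex"
  assumes h: "holomorphic_several_on h polydisk" and st: "s < t" "t < 1" and z: "z \<in> closed_polydisk s"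
    and B: "\<And>x. x \<in> closed_polydisk t \<Longrightarrow> norm (h x) \<le> B"
  shows "norm (partial_deriv k h z) \<le> B / (t - s)"
proof -
  define ins where "ins = (\<lambda>w. (\<chi> i. if i = k then w else z $ i) :: complex ^ 'n)"
  have ins: "ins w \<in> closed_polydisk t" if "norm (z $ k - w) \<le> t - s" for w
  proof -
    have zi: "norm (z $ i) \<le> s" for i using z by (simp add: closed_polydisk_def)
    have "norm w \<le> t" using that zi[of k] norm_triangle_ineq2[of w "z $ k"] by (simp add: norm_minus_commute)
    moreover have "norm (z $ i) \<le> t" for i using zi[of i] st by linarith
    ultimately show ?thesis by (simp add: closed_polydisk_def ins_def)
  qed
  have "(\<lambda>w. h (ins w)) field_differentiable (at w)" if "w \<in> cball (z $ k) (t - s)" for w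
  proof -
    have "ins w \<in> polydisk"
      using ins[of w] that closed_polydisk_subset_polydisk[OF st(2)] by (auto simp: dist_norm)
    then obtain D where D: "(h has_derivative D) (at (ins w))" "\<And>c v. D (c *s v) = c * D v"
      using h unfolding holomorphic_several_on_def by blast
    \<comment> \<open>Slicing again at a point of the slice gives the same slice, so
      differentiability at every \<open>w\<close> follows from
      \<open>has_field_derivative_slice\<close>.\<close>
    have "(\<chi> i. if i = k then w' else ins w $ i) = ins w'" for w'
      by (simp add: ins_def vec_eq_iff)
    then show ?thesis
      using has_field_derivative_slice[OF D, of k] by (auto simp: field_differentiable_def ins_def)
  qed
  then have hol: "(\<lambda>w. h (ins w)) holomorphic_on cball (z $ k) (t - s)"
    by (meson field_differentiable_at_within holomorphic_onI)
  have "norm ((deriv ^^ 1) (\<lambda>w. h (ins w)) (z $ k)) \<le> fact 1 * B / (t - s) ^ 1"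
  proof (rule Cauchy_inequality)
    show "(\<lambda>w. h (ins w)) holomorphic_on ball (z $ k) (t - s)"
      using hol by (rule holomorphic_on_subset) (rule ball_subset_cball)
    show "continuous_on (cball (z $ k) (t - s)) (\<lambda>w. h (ins w))"
      using hol by (rule holomorphic_on_imp_continuous_on)
    show "norm (h (ins w)) \<le> B" if "norm (z $ k - w) = t - s" for w using that by (intro B ins) simp
  qed (use st in simp)
  then show ?thesis by (simp add: partial_deriv_def ins_def)
qed

text \<open>Replaces the limit, chosen separately for each radius, by the pointwise
  \<open>lim\<close>, so that all radii share one limit function.\<close>

lemma uniform_limit_closed_polydisk_lim:
  fixes f :: "nat \<Rightarrow> complex ^ 'n \<Rightarrow> complex"
  assumes "uniform_limit (closed_polydisk s) f g sequentially"
  shows "uniform_limit (closed_polydisk s) f (\<lambda>z. lim (\<lambda>j. f j z)) sequentially"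
proof -
  have "lim (\<lambda>j. f j z) = g z" if "z \<in> closed_polydisk s" for z
    using tendsto_uniform_limitI[OF assms that] by (rule limI)
  then show ?thesis using assms by (simp cong: uniform_limit_cong')
qed

text \<open>The Cauchy estimate applied to differences \<open>f m - f n\<close> makes the partial
  derivatives uniformly Cauchy, at the price of shrinking the radius from \<open>t\<close> to
  \<open>s\<close>.\<close>

lemma uniform_limit_partial_deriv:
  fixes f :: "nat \<Rightarrow> complex ^ 'n \<Rightarrow> complex"
  assumes hol: "\<And>j. holomorphic_several_on (f j) polydisk" and st: "s < t" "t < 1"
    and lim: "uniform_limit (closed_polydisk t) f g sequentially"
  shows "uniform_limit (closed_polydisk s) (\<lambda>j. partial_deriv k (f j))
    (\<lambda>z. lim (\<lambda>j. partial_deriv k (f j) z)) sequentially"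
proof -
  have "uniformly_Cauchy_on (closed_polydisk s) (\<lambda>j. partial_deriv k (f j))"
    unfolding uniformly_Cauchy_on_def
  proof (intro allI impI)
    fix e :: real assume e: "0 < e"
    have "uniformly_Cauchy_on (closed_polydisk t) f"
      using lim by (intro uniformly_convergent_Cauchy) (auto simp: uniformly_convergent_on_def)
    moreover have "0 < e * (t - s) / 2" using e st by simp
    ultimately obtain N where N: "\<And>x m n. x \<in> closed_polydisk t \<Longrightarrow> N \<le> m \<Longrightarrow> N \<le> n \<Longrightarrow>
        dist (f m x) (f n x) < e * (t - s) / 2"
      unfolding uniformly_Cauchy_on_def by metis
    have "dist (partial_deriv k (f m) x) (partial_deriv k (f n) x) < e"
      if x: "x \<in> closed_polydisk s" and mn: "N \<le> m" "N \<le> n" for x m n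
    proof -
      have "x \<in> polydisk" using x closed_polydisk_subset_polydisk[of s] st by fastforce
      then have "dist (partial_deriv k (f m) x) (partial_deriv k (f n) x) =
          norm (partial_deriv k (\<lambda>z. f m z - f n z) x)"
        by (simp add: partial_deriv_diff[OF hol hol] dist_norm)
      also have "\<dots> \<le> (e * (t - s) / 2) / (t - s)"
        using N[OF _ mn] by (intro partial_deriv_cauchy_estimate[OF _ st x] holomorphic_several_on_diff hol)
          (auto simp: dist_norm intro: less_imp_le)
      also have "\<dots> = e / 2" using st by (simp add: field_simps)
      also have "\<dots> < e" using e by simp
      finally show ?thesis .
    qed
    then show "\<exists>N. \<forall>x\<in>closed_polydisk s. \<forall>m\<ge>N. \<forall>n\<ge>N.
        dist (partial_deriv k (f m) x) (partial_deriv k (f n) x) < e" by blast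
  qed
  then obtain g' where "uniform_limit (closed_polydisk s) (\<lambda>j. partial_deriv k (f j)) g' sequentially"
    using Cauchy_uniformly_convergent by (auto simp: uniformly_convergent_on_def)
  then show ?thesis by (rule uniform_limit_closed_polydisk_lim)
qed

text \<open>Weierstrass' theorem: on a ball around \<open>z\<close> inside a closed polydisk the
  derivatives converge uniformly, so limit and total derivative may be interchanged.\<close>

lemma has_derivative_locally_uniform_limit:
  fixes f :: "nat \<Rightarrow> complex ^ 'n \<Rightarrow> complex"
  assumes hol: "\<And>j. holomorphic_several_on (f j) polydisk"
    and lim: "\<And>t. t < 1 \<Longrightarrow> uniform_limit (closed_polydisk t) f g sequentially"
    and z: "z \<in> polydisk"
  shows "(g has_derivative (\<lambda>v. \<Sum>k\<in>UNIV. lim (\<lambda>j. partial_deriv k (f j) z) * v $ k)) (at z)"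
proof -
  obtain s where s: "0 < s" "s < 1" "z \<in> closed_polydisk s" using in_closed_polydisk_of_polydisk[OF z] .
  define t where "t = (s + 1) / 2"
  have t: "s < t" "t < 1" using s by (auto simp: t_def)
  let ?S = "ball z (t - s)"
  let ?D = "\<lambda>x v. \<Sum>k\<in>UNIV. lim (\<lambda>j. partial_deriv k (f j) x) * v $ k"
  have S: "?S \<subseteq> closed_polydisk t"
  proof
    fix x assume x: "x \<in> ?S"
    have "norm (x $ k) \<le> t" for k
    proof -
      have "norm (x $ k - z $ k) \<le> t - s"
        using Finite_Cartesian_Product.norm_nth_le[of "x - z" k] x by (simp add: dist_norm norm_minus_commute)
      moreover have "norm (z $ k) \<le> s" using s by (simp add: closed_polydisk_def)
      ultimately show ?thesis using norm_triangle_sub[of "x $ k" "z $ k"] by linarith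
    qed
    then show "x \<in> closed_polydisk t" by (simp add: closed_polydisk_def)
  qed
  then have SU: "?S \<subseteq> polydisk" using closed_polydisk_subset_polydisk[OF t(2)] by blast
  have conv: "(\<lambda>j. f j x) \<longlonglongrightarrow> g x" if "x \<in> ?S" for x
    using tendsto_uniform_limitI[OF lim[OF t(2)]] S that by blast
  have zS: "z \<in> ?S" using t by simp
  have "\<exists>h. \<forall>x\<in>?S. (\<lambda>j. f j x) \<longlonglongrightarrow> h x \<and> (h has_derivative ?D x) (at x within ?S)"
  proof (rule has_derivative_sequence[where ?x0.0 = z and l = "g z" and g' = ?D
        and f' = "\<lambda>j x v. \<Sum>k\<in>UNIV. partial_deriv k (f j) x * v $ k"])
    show "(f j has_derivative (\<lambda>v. \<Sum>k\<in>UNIV. partial_deriv k (f j) x * v $ k)) (at x within ?S)"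
      if "x \<in> ?S" for j x
    proof (rule has_derivative_at_withinI, rule holomorphic_several_on_gradient[OF hol])
      show "x \<in> polydisk" using that SU by blast
    qed
  next
    fix e :: real assume e: "0 < e"
    define n where "n = real CARD('n)"
    have n: "0 < n" by (simp add: n_def)
    have "\<forall>\<^sub>F j in sequentially. \<forall>x\<in>closed_polydisk t.
        dist (partial_deriv k (f j) x) (lim (\<lambda>j. partial_deriv k (f j) x)) < e / n" for k
    proof -
      \<comment> \<open>Uniform convergence of the derivatives on radius \<open>t\<close> needs
        convergence of the functions on a larger radius.\<close>
      have t': "t < (t + 1) / 2" "(t + 1) / 2 < 1" using t by auto
      show ?thesis
        using uniform_limitD[OF uniform_limit_partial_deriv[OF hol t' lim[OF t'(2)]]] e n by simp
    qed
    then have "\<forall>\<^sub>F j in sequentially. \<forall>k. \<forall>x\<in>closed_polydisk t.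
        dist (partial_deriv k (f j) x) (lim (\<lambda>j. partial_deriv k (f j) x)) < e / n"
      by (rule eventually_all_finite)
    then show "\<forall>\<^sub>F j in sequentially. \<forall>x\<in>?S. \<forall>v.
        norm ((\<Sum>k\<in>UNIV. partial_deriv k (f j) x * v $ k) - ?D x v) \<le> e * norm v"
    proof (rule eventually_mono, intro ballI allI)
      fix j x and v :: "complex ^ 'n"
      assume j: "\<forall>k. \<forall>x\<in>closed_polydisk t.
        dist (partial_deriv k (f j) x) (lim (\<lambda>j. partial_deriv k (f j) x)) < e / n" and x: "x \<in> ?S"
      have "(\<Sum>k\<in>UNIV. partial_deriv k (f j) x * v $ k) - ?D x v =
          (\<Sum>k\<in>UNIV. (partial_deriv k (f j) x - lim (\<lambda>j. partial_deriv k (f j) x)) * v $ k)"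
        by (simp add: sum_subtractf left_diff_distrib)
      also have "norm \<dots> \<le> (\<Sum>k\<in>(UNIV::'n set). e / n * norm v)"
      proof (rule sum_norm_le)
        fix k
        have "norm (partial_deriv k (f j) x - lim (\<lambda>j. partial_deriv k (f j) x)) \<le> e / n"
          using j subsetD[OF S x] unfolding dist_norm by (blast intro: less_imp_le)
        then show "norm ((partial_deriv k (f j) x - lim (\<lambda>j. partial_deriv k (f j) x)) * v $ k) \<le> e / n * norm v"
          unfolding norm_mult using e n
          by (intro mult_mono Finite_Cartesian_Product.norm_nth_le) auto
      qed
      also have "\<dots> = e * norm v" using n by (simp add: n_def[symmetric])
      finally show "norm ((\<Sum>k\<in>UNIV. partial_deriv k (f j) x * v $ k) - ?D x v) \<le> e * norm v" .
    qed
  qed (fact convex_ball zS conv[OF zS])+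
  then obtain h where h: "\<And>x. x \<in> ?S \<Longrightarrow> (\<lambda>j. f j x) \<longlonglongrightarrow> h x"
      "(h has_derivative ?D z) (at z within ?S)"
    using zS by blast
  \<comment> \<open>\<open>has_derivative_sequence\<close> only yields some differentiable limit
    \<open>h\<close>; uniqueness of limits identifies it with \<open>g\<close>.\<close>
  have "h x = g x" if "x \<in> ?S" for x using LIMSEQ_unique[OF h(1) conv] that by blast
  then show ?thesis
    using has_derivative_transform_within_open[of h "?D z" z UNIV ?S g] h(2) zS
    by (simp add: at_within_open[OF zS open_ball])
qed

section \<open>Montel's theorem for Bloch spaces\<close>

text \<open>Arzela-Ascoli on an exhaustion by closed polydisks, followed by a diagonal argument.
  Boundedness and equicontinuity both come from \<open>bloch_lipschitz\<close>.\<close>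

lemma bloch_locally_uniform_subsequence:
  fixes f :: "nat \<Rightarrow> complex ^ 'n \<Rightarrow> complex"
  assumes f: "\<And>j. f j \<in> bloch_space p" "\<And>j. bloch_norm p (f j) \<le> C" and p: "0 \<le> p"
  obtains r where "strict_mono r"
    "\<forall>t<1. uniform_limit (closed_polydisk t) (\<lambda>j. f (r j)) (\<lambda>z. lim (\<lambda>j. f (r j) z)) sequentially"
proof -
  define \<rho> where "\<rho> i = 1 - inverse (real (Suc i))" for i
  have \<rho>: "0 \<le> \<rho> i" "\<rho> i < 1" for i by (auto simp: \<rho>_def field_simps)
  let ?P = "\<lambda>i \<sigma>. \<exists>g. uniform_limit (closed_polydisk (\<rho> i)) (\<lambda>j. f (\<sigma> j)) g sequentially"
  have C: "0 \<le> C" using order_trans[OF bloch_norm_nonneg[OF f(1)] f(2)] .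
  obtain r where r: "strict_mono r" "\<And>i. ?P i (id \<circ> r)"
  proof (rule subsequence_diagonalization_lemma[of ?P id])
    fix i :: nat and \<sigma> :: "nat \<Rightarrow> nat"
    define L where "L = real CARD('n) / (1 - (\<rho> i)\<^sup>2) powr p * C"
    have L: "0 \<le> L" using C by (simp add: L_def)
    have lip: "norm (f j x - f j y) \<le> L * norm (x - y)"
      if "x \<in> closed_polydisk (\<rho> i)" "y \<in> closed_polydisk (\<rho> i)" for j x y
    proof -
      have "norm (f j x - f j y) \<le> real CARD('n) / (1 - (\<rho> i)\<^sup>2) powr p * bloch_norm p (f j) * norm (x - y)"
        by (rule bloch_lipschitz[OF f(1) p \<rho>(2) that])
      also have "\<dots> \<le> L * norm (x - y)"
        unfolding L_def using f(2) by (intro mult_right_mono mult_left_mono) auto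
      finally show ?thesis .
    qed
    have bdd: "bounded (closed_polydisk (\<rho> i) :: (complex ^ 'n) set)"
      using compact_closed_polydisk by (rule compact_imp_bounded)
    then obtain R where R: "\<And>x :: complex ^ 'n. x \<in> closed_polydisk (\<rho> i) \<Longrightarrow> norm x \<le> R"
      by (auto simp: bounded_iff)
    obtain g k where "strict_mono (k :: nat \<Rightarrow> nat)"
      and k: "\<And>e. 0 < e \<Longrightarrow> \<exists>N. \<forall>n x. n \<ge> N \<and> x \<in> closed_polydisk (\<rho> i) \<longrightarrow> norm (f (\<sigma> (k n)) x - g x) < e"
    proof (rule Arzela_Ascoli[OF compact_closed_polydisk, of "\<rho> i" "\<lambda>j. f (\<sigma> j)" "C + L * R"])
      show "norm (f (\<sigma> j) x) \<le> C + L * R" if x: "x \<in> closed_polydisk (\<rho> i)" for j x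
      proof -
        have "norm (f (\<sigma> j) 0) \<le> bloch_norm p (f (\<sigma> j))"
          by (rule norm_at_zero_le_bloch_norm[OF f(1)])
        moreover have "norm (f (\<sigma> j) x - f (\<sigma> j) 0) \<le> L * norm (x - 0)"
          by (rule lip[OF x zero_in_closed_polydisk[OF \<rho>(1)]])
        moreover have "L * norm x \<le> L * R" using R[OF x] L by (rule mult_left_mono)
        ultimately show ?thesis
          using norm_triangle_sub[of "f (\<sigma> j) x" "f (\<sigma> j) 0"] f(2)[of "\<sigma> j"] by simp
      qed
      show "\<exists>d>0. \<forall>n y. y \<in> closed_polydisk (\<rho> i) \<and> norm (x - y) < d \<longrightarrow> norm (f (\<sigma> n) x - f (\<sigma> n) y) < e"
        if x: "x \<in> closed_polydisk (\<rho> i)" and e: "0 < e" for x e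
      proof (intro exI conjI allI impI)
        \<comment> \<open>\<open>L + 1\<close> instead of \<open>L\<close>, since \<open>L\<close>
          may be 0.\<close>
        show "0 < e / (L + 1)" using e L by simp
        fix n y assume y: "y \<in> closed_polydisk (\<rho> i) \<and> norm (x - y) < e / (L + 1)"
        have "norm (f (\<sigma> n) x - f (\<sigma> n) y) \<le> L * norm (x - y)" using lip[OF x] y by blast
        also have "\<dots> \<le> (L + 1) * norm (x - y)" by (intro mult_right_mono) auto
        also have "\<dots> < e" using y L by (simp add: field_simps)
        finally show "norm (f (\<sigma> n) x - f (\<sigma> n) y) < e" .
      qed
    qed blast
    have "uniform_limit (closed_polydisk (\<rho> i)) (\<lambda>j. f (\<sigma> (k j))) g sequentially"
      unfolding uniform_limit_sequentially_iff dist_norm using k by metis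
    with \<open>strict_mono k\<close> show "\<exists>k. strict_mono k \<and> ?P i (\<sigma> \<circ> k)" by (auto simp: o_def)
  next
    \<comment> \<open>Stability required by the diagonal argument: from \<open>N\<close> on,
      \<open>k2\<close> takes values of \<open>k1\<close> at indices no smaller than its own, so it
      inherits the tail estimates.\<close>
    fix i N and \<sigma> k1 k2 :: "nat \<Rightarrow> nat"
    assume "?P i (\<sigma> \<circ> k1)" and k: "\<And>j. N \<le> j \<Longrightarrow> \<exists>j'. j \<le> j' \<and> k2 j = k1 j'"
    then obtain g where g: "uniform_limit (closed_polydisk (\<rho> i)) (\<lambda>j. f (\<sigma> (k1 j))) g sequentially"
      by (auto simp: o_def)
    have "uniform_limit (closed_polydisk (\<rho> i)) (\<lambda>j. f (\<sigma> (k2 j))) g sequentially"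
      unfolding uniform_limit_sequentially_iff
    proof (intro allI impI)
      fix e :: real assume "0 < e"
      then obtain N' where N': "\<And>j x. N' \<le> j \<Longrightarrow> x \<in> closed_polydisk (\<rho> i) \<Longrightarrow> dist (f (\<sigma> (k1 j)) x) (g x) < e"
        using g unfolding uniform_limit_sequentially_iff by metis
      have "dist (f (\<sigma> (k2 j)) x) (g x) < e" if "max N N' \<le> j" "x \<in> closed_polydisk (\<rho> i)" for j x
        using k[of j] N' that by (metis max.bounded_iff order_trans)
      then show "\<exists>N. \<forall>n\<ge>N. \<forall>x\<in>closed_polydisk (\<rho> i). dist (f (\<sigma> (k2 n)) x) (g x) < e" by blast
    qed
    then show "?P i (\<sigma> \<circ> k2)" by (auto simp: o_def)
  qed blast
  show thesis
  proof (rule that[OF r(1)], intro allI impI)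
    fix t :: real assume "t < 1"
    then obtain i where "inverse (real (Suc i)) < 1 - t" using reals_Archimedean[of "1 - t"] by auto
    then have "t \<le> \<rho> i" by (simp add: \<rho>_def)
    obtain g where "uniform_limit (closed_polydisk (\<rho> i)) (\<lambda>j. f (r j)) g sequentially"
      using r(2)[of i] by auto
    then have "uniform_limit (closed_polydisk t) (\<lambda>j. f (r j)) g sequentially"
      by (rule uniform_limit_on_subset) (rule closed_polydisk_mono[OF \<open>t \<le> \<rho> i\<close>])
    then show "uniform_limit (closed_polydisk t) (\<lambda>j. f (r j)) (\<lambda>z. lim (\<lambda>j. f (r j) z)) sequentially"
      by (rule uniform_limit_closed_polydisk_lim)
  qed
qed

text \<open>Each Bloch sum is at most \<open>C\<close> and passes to the limit at every point. The
  value at 0 is bounded by \<open>C\<close> separately, hence the factor 2.\<close>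

lemma bloch_montel:
  fixes f :: "nat \<Rightarrow> complex ^ 'n \<Rightarrow> complex"
  assumes f: "\<And>j. f j \<in> bloch_space p" "\<And>j. bloch_norm p (f j) \<le> C" and p: "0 \<le> p"
  obtains g r where "strict_mono r" "g \<in> bloch_space p" "bloch_norm p g \<le> 2 * C"
    "\<forall>z\<in>polydisk. (\<lambda>j. f (r j) z) \<longlonglongrightarrow> g z"
    "\<forall>s<1. \<forall>k. uniform_limit (closed_polydisk s)
       (\<lambda>j. partial_deriv k (f (r j))) (partial_deriv k g) sequentially"
proof -
  obtain r where r: "strict_mono r" and lim: "\<forall>t<1.
      uniform_limit (closed_polydisk t) (\<lambda>j. f (r j)) (\<lambda>z. lim (\<lambda>j. f (r j) z)) sequentially"
    using bloch_locally_uniform_subsequence[OF f p] .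
  define g where "g z = lim (\<lambda>j. f (r j) z)" for z
  define G where "G z k = lim (\<lambda>j. partial_deriv k (f (r j)) z)" for z k
  have hol: "holomorphic_several_on (f (r j)) polydisk" for j using f(1) by (simp add: bloch_space_def)
  have glim: "uniform_limit (closed_polydisk t) (\<lambda>j. f (r j)) g sequentially" if "t < 1" for t
    using lim that unfolding g_def by blast
  have der: "(g has_derivative (\<lambda>v. \<Sum>k\<in>UNIV. G z k * v $ k)) (at z)" if "z \<in> polydisk" for z
    unfolding G_def by (rule has_derivative_locally_uniform_limit[OF hol glim that])
  have pd: "partial_deriv k g z = G z k" if "z \<in> polydisk" for z k
    by (rule partial_deriv_eqI[OF der[OF that]])
  have ulim: "uniform_limit (closed_polydisk s) (\<lambda>j. partial_deriv k (f (r j))) (partial_deriv k g) sequentially"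
    if s: "s < 1" for s k
  proof -
    have s': "s < (s + 1) / 2" "(s + 1) / 2 < 1" using s by auto
    have "uniform_limit (closed_polydisk s) (\<lambda>j. partial_deriv k (f (r j))) (\<lambda>z. G z k) sequentially"
      unfolding G_def by (rule uniform_limit_partial_deriv[OF hol s' glim[OF s'(2)]])
    moreover have "G z k = partial_deriv k g z" if "z \<in> closed_polydisk s" for z
      using pd closed_polydisk_subset_polydisk[OF s] that by fastforce
    ultimately show ?thesis by (simp cong: uniform_limit_cong')
  qed
  have conv: "(\<lambda>j. f (r j) z) \<longlonglongrightarrow> g z" if z: "z \<in> polydisk" for z
  proof -
    obtain s where s: "0 < s" "s < 1" "z \<in> closed_polydisk s" using in_closed_polydisk_of_polydisk[OF z] .
    show ?thesis by (rule tendsto_uniform_limitI[OF glim[OF s(2)] s(3)])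
  qed
  have sum: "(\<Sum>k\<in>UNIV. norm (G z k) * (1 - (norm (z $ k))\<^sup>2) powr p) \<le> C" if z: "z \<in> polydisk" for z
  proof -
    obtain s where s: "0 < s" "s < 1" "z \<in> closed_polydisk s" using in_closed_polydisk_of_polydisk[OF z] .
    have "(\<lambda>j. partial_deriv k (f (r j)) z) \<longlonglongrightarrow> G z k" for k
      using tendsto_uniform_limitI[OF ulim[OF s(2)] s(3)] by (simp only: pd[OF z])
    then have "(\<lambda>j. bloch_sum p (f (r j)) z) \<longlonglongrightarrow> (\<Sum>k\<in>UNIV. norm (G z k) * (1 - (norm (z $ k))\<^sup>2) powr p)"
      unfolding bloch_sum_def by (intro tendsto_intros)
    moreover have "bloch_sum p (f (r j)) z \<le> C" for j
      using bloch_sum_le_SUP[OF f(1) z, of "r j"] f(2)[of "r j"] norm_ge_zero[of "f (r j) 0"]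
      unfolding bloch_norm_def by linarith
    ultimately show ?thesis by (intro LIMSEQ_le_const2) auto
  qed
  \<comment> \<open>Membership in the Bloch space includes the extension by zero; \<open>lim\<close>
    of a zero sequence provides it.\<close>
  have zero: "g z = 0" if "z \<notin> polydisk" for z
  proof -
    have "f (r j) z = 0" for j using f(1)[of "r j"] that by (simp add: bloch_space_def)
    then show ?thesis by (simp add: g_def)
  qed
  note g = bloch_spaceI[OF der sum zero]
  have "norm (f (r j) 0) \<le> C" for j
    by (rule order_trans[OF norm_at_zero_le_bloch_norm[OF f(1)] f(2)])
  then have "norm (g 0) \<le> C"
    using tendsto_norm[OF conv[OF zero_in_polydisk]] by (intro LIMSEQ_le_const2) auto
  then have "bloch_norm p g \<le> 2 * C" using g(2) by simp
  with conv ulim show thesis by (intro that[OF r g(1)]) auto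
qed

section \<open>Compactness from the boundary condition\<close>

text \<open>In the chain rule the weight at \<open>\<phi> z\<close> cancels the denominator of
  \<open>bloch_term\<close>. Since \<open>z\<close> is fixed, \<open>A\<close> may be chosen
  differently near the boundary and away from it.\<close>

lemma bloch_sum_composition_op_le:
  fixes \<phi> :: "complex ^ 'n \<Rightarrow> complex ^ 'n"
  assumes \<phi>: "holomorphic_self_map \<phi>" and h: "holomorphic_several_on h polydisk" and z: "z \<in> polydisk"
    and A: "\<And>l. norm (partial_deriv l h (\<phi> z)) * (1 - (norm (\<phi> z $ l))\<^sup>2) powr p \<le> A"
  shows "bloch_sum q (composition_op \<phi> h) z \<le> A * bloch_quotient p q \<phi> z"
proof -
  have w: "0 < 1 - (norm (\<phi> z $ l))\<^sup>2" for l using \<phi> z by (intro weight_pos) (auto simp: holomorphic_self_map_def)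
  have "norm (partial_deriv k (composition_op \<phi> h) z) * (1 - (norm (z $ k))\<^sup>2) powr q \<le>
      (\<Sum>l\<in>UNIV. A * bloch_term p q \<phi> k l z)" for k
  proof -
    have "norm (partial_deriv k (composition_op \<phi> h) z) \<le>
        (\<Sum>l\<in>UNIV. norm (partial_deriv l h (\<phi> z) * partial_deriv k (\<lambda>w. \<phi> w $ l) z))"
      unfolding partial_deriv_eqI[OF has_derivative_composition_op[OF \<phi> h z]] by (rule norm_sum)
    then have "norm (partial_deriv k (composition_op \<phi> h) z) * (1 - (norm (z $ k))\<^sup>2) powr q \<le>
        (\<Sum>l\<in>UNIV. norm (partial_deriv l h (\<phi> z) * partial_deriv k (\<lambda>w. \<phi> w $ l) z) * (1 - (norm (z $ k))\<^sup>2) powr q)"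
      unfolding sum_distrib_right[symmetric] by (rule mult_right_mono) simp
    also have "\<dots> = (\<Sum>l\<in>UNIV. (norm (partial_deriv l h (\<phi> z)) * (1 - (norm (\<phi> z $ l))\<^sup>2) powr p) *
        bloch_term p q \<phi> k l z)"
      using w by (intro sum.cong) (simp_all add: bloch_term_def norm_mult less_imp_neq[symmetric])
    also have "\<dots> \<le> (\<Sum>l\<in>UNIV. A * bloch_term p q \<phi> k l z)"
      by (intro sum_mono mult_right_mono A bloch_term_nonneg)
    finally show ?thesis .
  qed
  then have "bloch_sum q (composition_op \<phi> h) z \<le> (\<Sum>k\<in>UNIV. \<Sum>l\<in>UNIV. A * bloch_term p q \<phi> k l z)"
    unfolding bloch_sum_def by (rule sum_mono)
  then show ?thesis by (simp add: bloch_quotient_eq sum_distrib_left)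
qed

lemma composition_op_in_bloch_space:
  fixes \<phi> :: "complex ^ 'n \<Rightarrow> complex ^ 'n"
  assumes \<phi>: "holomorphic_self_map \<phi>" and M: "\<And>z. z \<in> polydisk \<Longrightarrow> bloch_quotient p q \<phi> z \<le> M"
    and f: "f \<in> bloch_space p"
  shows "composition_op \<phi> f \<in> bloch_space q"
proof -
  have hol: "holomorphic_several_on f polydisk" using f by (simp add: bloch_space_def)
  have "bloch_sum q (composition_op \<phi> f) z \<le> bloch_norm p f * M" if z: "z \<in> polydisk" for z
  proof -
    have "\<phi> z \<in> polydisk" using \<phi> z by (auto simp: holomorphic_self_map_def)
    then have "bloch_sum q (composition_op \<phi> f) z \<le> bloch_norm p f * bloch_quotient p q \<phi> z"
      by (intro bloch_sum_composition_op_le \<phi> hol z partial_deriv_le_bloch_norm f)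
    also have "\<dots> \<le> bloch_norm p f * M" using M[OF z] bloch_norm_nonneg[OF f] by (rule mult_left_mono)
    finally show ?thesis .
  qed
  then have "bdd_above (bloch_sum q (composition_op \<phi> f) ` polydisk)" by (rule bdd_aboveI2)
  moreover have "holomorphic_several_on (composition_op \<phi> f) polydisk"
    by (rule holomorphic_several_onI[OF has_derivative_composition_op[OF \<phi> hol]])
  ultimately show ?thesis by (simp add: bloch_space_def composition_op_def)
qed

text \<open>Where \<open>\<phi> z\<close> is near the boundary, the weighted derivatives are bounded
  by \<open>C\<close> and the quotient is small. Elsewhere \<open>\<phi> z\<close> lies in a fixed
  closed polydisk, where the derivatives are uniformly small and the quotient is at most
  \<open>M\<close>.\<close>

lemma composition_op_norm_null:
  fixes \<phi> :: "complex ^ 'n \<Rightarrow> complex ^ 'n" and h :: "nat \<Rightarrow> complex ^ 'n \<Rightarrow> complex"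
  assumes \<phi>: "holomorphic_self_map \<phi>" and M: "\<And>z. z \<in> polydisk \<Longrightarrow> bloch_quotient p q \<phi> z \<le> M"
    and tz: "tendsto_zero_at_boundary \<phi> (bloch_quotient p q \<phi>)" and p: "0 \<le> p"
    and h: "\<And>j. h j \<in> bloch_space p" "\<And>j. bloch_norm p (h j) \<le> C"
    and null: "\<And>z. z \<in> polydisk \<Longrightarrow> (\<lambda>j. h j z) \<longlonglongrightarrow> 0"
    and lim: "\<And>s k. s < 1 \<Longrightarrow> uniform_limit (closed_polydisk s) (\<lambda>j. partial_deriv k (h j)) (\<lambda>_. 0) sequentially"
  shows "(\<lambda>j. bloch_norm q (composition_op \<phi> (h j))) \<longlonglongrightarrow> 0"
proof (rule LIMSEQ_I)
  fix e :: real assume e: "0 < e"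
  have \<phi>U: "\<phi> z \<in> polydisk" if "z \<in> polydisk" for z using \<phi> that by (auto simp: holomorphic_self_map_def)
  have hol: "holomorphic_several_on (h j) polydisk" for j using h(1) by (simp add: bloch_space_def)
  have C: "0 \<le> C" using order_trans[OF bloch_norm_nonneg[OF h(1)] h(2)] .
  have M0: "0 \<le> M" using order_trans[OF bloch_quotient_nonneg M[OF zero_in_polydisk]] .
  \<comment> \<open>One third of \<open>e\<close> goes to the Bloch sum and one third to the value
    at 0; adding 1 to \<open>C\<close> and \<open>M\<close> avoids division by zero.\<close>
  have "0 < e / (3 * (C + 1))" using e C by simp
  then obtain \<delta> where \<delta>: "0 < \<delta>" "\<And>z. z \<in> polydisk \<Longrightarrow> infdist (\<phi> z) (frontier polydisk) < \<delta> \<Longrightarrow>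
      \<bar>bloch_quotient p q \<phi> z\<bar> < e / (3 * (C + 1))"
    using tz unfolding tendsto_zero_at_boundary_def by metis
  have \<eta>: "0 < e / (3 * (M + 1))" using e M0 by simp
  have "\<forall>\<^sub>F j in sequentially. \<forall>k. \<forall>x\<in>closed_polydisk (1 - \<delta>). dist (partial_deriv k (h j) x) 0 < e / (3 * (M + 1))"
    using \<delta>(1) by (intro eventually_all_finite uniform_limitD[OF lim \<eta>]) simp
  \<comment> \<open>The composite takes the value \<open>h j (\<phi> 0)\<close> at 0, so convergence
    is needed at \<open>\<phi> 0\<close>.\<close>
  moreover have "\<forall>\<^sub>F j in sequentially. dist (h j (\<phi> 0)) 0 < e / 3"
    using tendstoD[OF null[OF \<phi>U[OF zero_in_polydisk]], of "e / 3"] e by simp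
  ultimately have "\<forall>\<^sub>F j in sequentially. norm (bloch_norm q (composition_op \<phi> (h j)) - 0) < e"
  proof eventually_elim
    case (elim j)
    have "bloch_sum q (composition_op \<phi> (h j)) z \<le> e / 3" if z: "z \<in> polydisk" for z
    proof (cases "infdist (\<phi> z) (frontier polydisk) < \<delta>")
      case True
      have "bloch_sum q (composition_op \<phi> (h j)) z \<le> C * bloch_quotient p q \<phi> z"
        by (intro bloch_sum_composition_op_le \<phi> hol z order_trans[OF partial_deriv_le_bloch_norm h(2)] h \<phi>U)
      also have "\<dots> \<le> (C + 1) * (e / (3 * (C + 1)))"
        using \<delta>(2)[OF z True] C by (intro mult_mono) (auto simp: bloch_quotient_nonneg)
      also have "\<dots> = e / 3" using C by (simp add: field_simps)
      finally show ?thesis .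
    next
      case False
      then have "\<phi> z \<in> closed_polydisk (1 - \<delta>)"
        by (intro le_infdist_frontier_polydisk \<phi>U z) (simp add: not_less)
      then have small: "norm (partial_deriv l (h j) (\<phi> z)) \<le> e / (3 * (M + 1))" for l
        using elim(1) by (auto intro: less_imp_le)
      have "norm (partial_deriv l (h j) (\<phi> z)) * (1 - (norm (\<phi> z $ l))\<^sup>2) powr p \<le> e / (3 * (M + 1)) * 1" for l
        using \<eta> by (intro mult_mono small weight_le_1 \<phi>U z p) auto
      then have "bloch_sum q (composition_op \<phi> (h j)) z \<le> e / (3 * (M + 1)) * bloch_quotient p q \<phi> z"
        by (intro bloch_sum_composition_op_le \<phi> hol z) simp
      also have "\<dots> \<le> e / (3 * (M + 1)) * (M + 1)"
        using M[OF z] \<eta> by (intro mult_left_mono) auto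
      also have "\<dots> = e / 3" using M0 by (simp add: field_simps)
      finally show ?thesis .
    qed
    then have "bloch_norm q (composition_op \<phi> (h j)) \<le> norm (composition_op \<phi> (h j) 0) + e / 3"
      by (rule bloch_norm_le)
    moreover have "norm (composition_op \<phi> (h j) 0) < e / 3"
      using elim(2) by (simp add: composition_op_def zero_in_polydisk)
    moreover have "0 \<le> bloch_norm q (composition_op \<phi> (h j))"
      by (intro bloch_norm_nonneg composition_op_in_bloch_space[OF \<phi> M] h)
    ultimately show ?case using e by simp
  qed
  then show "\<exists>N. \<forall>j\<ge>N. norm (bloch_norm q (composition_op \<phi> (h j)) - 0) < e"
    by (simp add: eventually_sequentially)
qed

text \<open>By the Bolzano-Weierstrass criterion it suffices that each infinite subset of
  \<open>S\<close> has an accumulation point; the subsequential limit of an injective sequence in it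
  is one.\<close>

lemma (in Metric_space) compactin_closure_of_sequentially:
  assumes "\<And>\<sigma> :: nat \<Rightarrow> 'a. range \<sigma> \<subseteq> S \<Longrightarrow> \<exists>l r. strict_mono r \<and> limitin mtopology (\<sigma> \<circ> r) l sequentially"
  shows "compactin mtopology (mtopology closure_of S)"
  unfolding compact_closure_of_eq_Bolzano_Weierstrass
proof (intro allI impI)
  fix T assume T: "infinite T \<and> T \<subseteq> S \<and> T \<subseteq> M"
  then obtain \<sigma> :: "nat \<Rightarrow> 'a" where \<sigma>: "inj \<sigma>" "range \<sigma> \<subseteq> T" using infinite_countable_subset by blast
  then obtain l r where r: "strict_mono r" and lim: "limitin mtopology (\<sigma> \<circ> r) l sequentially"
    using assms[of \<sigma>] T by blast
  have "\<exists>y. y \<noteq> l \<and> y \<in> T \<and> y \<in> U" if U: "l \<in> U" "openin mtopology U" for U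
  proof -
    obtain N where N: "\<And>j. N \<le> j \<Longrightarrow> \<sigma> (r j) \<in> U"
      using lim U unfolding limitin_sequentially by auto
    \<comment> \<open>Of two distinct terms in \<open>U\<close>, at least one differs from
      \<open>l\<close>.\<close>
    have "\<sigma> (r N) \<noteq> \<sigma> (r (Suc N))"
      using \<sigma>(1) r by (metis injD strict_mono_eq n_not_Suc_n)
    then show ?thesis using N[of N] N[of "Suc N"] \<sigma>(2) by (metis le_SucI order_refl rangeI subsetD)
  qed
  then have "l \<in> mtopology derived_set_of T"
    using limitin_mspace[OF lim] by (auto simp: in_derived_set_of)
  then show "mtopology derived_set_of T \<noteq> {}" by blast
qed

text \<open>A sequence of images is pulled back to a bounded sequence, and Montel supplies a limit
  \<open>g\<close>. The differences \<open>h j\<close> from \<open>g\<close> form a bounded sequence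
  tending to 0 together with their gradients, so their images are norm null.\<close>

lemma compact_composition_op:
  fixes \<phi> :: "complex ^ 'n \<Rightarrow> complex ^ 'n"
  assumes \<phi>: "holomorphic_self_map \<phi>" and M: "\<And>z. z \<in> polydisk \<Longrightarrow> bloch_quotient p q \<phi> z \<le> M"
    and tz: "tendsto_zero_at_boundary \<phi> (bloch_quotient p q \<phi>)" and p: "0 \<le> p"
  shows "compact_operator (bloch_space p) (bloch_norm p) (bloch_space q) (bloch_norm q) (composition_op \<phi>)"
  unfolding compact_operator_def
proof (intro conjI allI impI ballI)
  let ?T = "composition_op \<phi>"
  have TY: "?T f \<in> bloch_space q" if "f \<in> bloch_space p" for f
    by (rule composition_op_in_bloch_space[OF \<phi> M that])
  show "?T ` bloch_space p \<subseteq> bloch_space q" using TY by blast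
  show "?T (\<lambda>z. a * f z + b * g z) = (\<lambda>z. a * ?T f z + b * ?T g z)" for f g a b
    by (simp add: composition_op_def fun_eq_iff)
  fix B :: "(complex ^ 'n \<Rightarrow> complex) set"
  assume B: "B \<subseteq> bloch_space p" and "\<exists>C. \<forall>f\<in>B. bloch_norm p f \<le> C"
  then obtain C where C: "\<And>f. f \<in> B \<Longrightarrow> bloch_norm p f \<le> C" by blast
  interpret Metric_space "bloch_space q" "norm_dist (bloch_space q) (bloch_norm q)"
    by (rule Metric_space_bloch)
  show "compactin (norm_topology (bloch_space q) (bloch_norm q))
      (norm_topology (bloch_space q) (bloch_norm q) closure_of (?T ` B))"
    unfolding norm_topology_def
  proof (rule compactin_closure_of_sequentially)
    fix \<sigma> :: "nat \<Rightarrow> complex ^ 'n \<Rightarrow> complex" assume "range \<sigma> \<subseteq> ?T ` B"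
    then have "\<forall>j. \<exists>f\<in>B. \<sigma> j = ?T f" by blast
    then obtain f where f: "\<And>j. f j \<in> B" "\<And>j. \<sigma> j = ?T (f j)" by metis
    have fb: "f j \<in> bloch_space p" for j using f(1) B by blast
    obtain g r where r: "strict_mono r" and g: "g \<in> bloch_space p" "bloch_norm p g \<le> 2 * C"
      and conv: "\<forall>z\<in>polydisk. (\<lambda>j. f (r j) z) \<longlonglongrightarrow> g z"
      and ulim: "\<forall>s<1. \<forall>k. uniform_limit (closed_polydisk s)
        (\<lambda>j. partial_deriv k (f (r j))) (partial_deriv k g) sequentially"
      using bloch_montel[OF fb C[OF f(1)] p] .
    define h where "h j z = f (r j) z - g z" for j z
    have hol: "holomorphic_several_on (f (r j)) polydisk" "holomorphic_several_on g polydisk" for j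
      using fb g(1) by (auto simp: bloch_space_def)
    have "(\<lambda>j. bloch_norm q (?T (h j))) \<longlonglongrightarrow> 0"
    proof (rule composition_op_norm_null[OF \<phi> M tz p])
      show "h j \<in> bloch_space p" for j unfolding h_def by (rule bloch_space_diff[OF fb g(1)])
      show "bloch_norm p (h j) \<le> C + 2 * C" for j
        using bloch_space_diff(2)[OF fb g(1), of "r j"] C[OF f(1), of "r j"] g(2)
        by (simp add: h_def[abs_def])
      show "(\<lambda>j. h j z) \<longlonglongrightarrow> 0" if "z \<in> polydisk" for z
        using conv that by (simp add: h_def LIM_zero)
      show "uniform_limit (closed_polydisk s) (\<lambda>j. partial_deriv k (h j)) (\<lambda>_. 0) sequentially"
        if s: "s < 1" for s k
      proof -
        have "partial_deriv k (h j) z = partial_deriv k (f (r j)) z - partial_deriv k g z"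
          if "z \<in> closed_polydisk s" for j z
          unfolding h_def using that closed_polydisk_subset_polydisk[OF s]
          by (intro partial_deriv_diff[OF hol]) blast
        then show ?thesis
          using ulim s by (simp add: uniform_limit_iff dist_norm)
      qed
    qed
    moreover have "?T (h j) = (\<lambda>z. ?T (f (r j)) z - ?T g z)" for j
      by (auto simp: composition_op_def h_def)
    ultimately have "limitin mtopology (\<sigma> \<circ> r) (?T g) sequentially"
      unfolding limitin_metric_dist_null using TY[OF fb] TY[OF g(1)]
      by (simp add: f(2) norm_dist_def)
    with r show "\<exists>l r. strict_mono r \<and> limitin mtopology (\<sigma> \<circ> r) l sequentially" by blast
  qed
qed

lemma compact_operator_subset:
  assumes "compact_operator X NX Y NY T" "X' \<subseteq> X"
  shows "compact_operator X' NX Y NY T"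
proof -
  have "T ` X' \<subseteq> Y" using assms unfolding compact_operator_def by blast
  moreover have "\<forall>f\<in>X'. \<forall>g\<in>X'. \<forall>a b. T (\<lambda>z. a * f z + b * g z) = (\<lambda>z. a * T f z + b * T g z)"
    using assms unfolding compact_operator_def by blast
  moreover have "compactin (norm_topology Y NY) (norm_topology Y NY closure_of (T ` B))"
    if "B \<subseteq> X'" "\<exists>C. \<forall>f\<in>B. NX f \<le> C" for B
    using assms that unfolding compact_operator_def by (meson subset_trans)
  ultimately show ?thesis unfolding compact_operator_def by blast
qed

theorem theorem3p3:
  fixes \<phi> :: "complex ^ 'n \<Rightarrow> complex ^ 'n" and p q :: real
  assumes "holomorphic_self_map \<phi>" and "p > 0" and "q > 0"
  shows
    "(tendsto_zero_at_boundary \<phi> (bloch_quotient p q \<phi>) \<and>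
      (\<exists>M\<ge>0. \<forall>z\<in>polydisk. bloch_quotient p q \<phi> z \<le> M)
      \<longrightarrow>
      compact_operator (bloch_space p) (bloch_norm p) (bloch_space q) (bloch_norm q)
        (composition_op \<phi>) \<and>
      compact_operator (little_bloch_space p) (bloch_norm p) (bloch_space q) (bloch_norm q)
        (composition_op \<phi>))
     \<and>
     (p \<ge> 1 \<longrightarrow>
      compact_operator (bloch_space p) (bloch_norm p) (bloch_space q) (bloch_norm q)
        (composition_op \<phi>) \<or>
      compact_operator (little_bloch_space p) (bloch_norm p) (bloch_space q) (bloch_norm q)
        (composition_op \<phi>)
      \<longrightarrow>
      tendsto_zero_at_boundary \<phi> (bloch_quotient p q \<phi>))"
proof (intro conjI impI)
  assume "tendsto_zero_at_boundary \<phi> (bloch_quotient p q \<phi>) \<and>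
      (\<exists>M\<ge>0. \<forall>z\<in>polydisk. bloch_quotient p q \<phi> z \<le> M)"
  then show big: "compact_operator (bloch_space p) (bloch_norm p) (bloch_space q) (bloch_norm q)
      (composition_op \<phi>)"
    using compact_composition_op[OF assms(1)] assms(2) by (meson less_imp_le)
  show "compact_operator (little_bloch_space p) (bloch_norm p) (bloch_space q) (bloch_norm q)
      (composition_op \<phi>)"
    using big little_bloch_space_subset by (rule compact_operator_subset)
next
  assume "1 \<le> p" and "compact_operator (bloch_space p) (bloch_norm p) (bloch_space q) (bloch_norm q)
        (composition_op \<phi>) \<or>
      compact_operator (little_bloch_space p) (bloch_norm p) (bloch_space q) (bloch_norm q)
        (composition_op \<phi>)"
  then show "tendsto_zero_at_boundary \<phi> (bloch_quotient p q \<phi>)"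
    using compact_imp_tendsto_zero_at_boundary[OF _ _ _ assms(1)] assms(3)
      compact_operator_subset[OF _ little_bloch_space_subset] by (meson less_imp_le)
qed

end
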